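(* Let $d\ge2$ be an integer. There exist constants $C_1>0$ and $C_2>0$ depending only on $d$ such that the following holds. Let $N\ge2$, $K\ge1$, $M\ge1$ be integers, let $\bm{X}\in\mathbb{R}^{N^d}$ be such that $D\bm{X}$ has at most $K$ nonzero entries, let $A\in\mathbb{R}^{M\times N^d}$ be a random matrix with i.i.d. $\mathcal{N}(0,1)$ entries, and let $\bm{Y}=A\bm{X}$. If $$M\ \ge\ \begin{cases} C_1\,K\log_2^2N\,\ln N & \text{if } d=2,\\ C_2\,K\ln N & \text{if } d>2,\end{cases}$$ then, with high probability, the unique solution of $$\min_{\bm{U}\in\mathbb{R}^{N^d}}\ \|D\bm{U}\|_1\quad\text{subject to}\quad \bm{Y}=A\bm{U}$$ is exactly $\bm{X}$. Here "with high probability" means: for every $\eta>0$ there is $N_0$ (depending on $\eta$ and $d$) such that for all $N\ge N_0$, all integers $K\ge1$ and $M\ge1$ with $M\ge C_1\,K\log_2^2N\,\ln N$ if $d=2$ and $M\ge C_2\,K\ln N$ if $d>2$, and all $\bm{X}\in\mathbb{R}^{N^d}$ such that $D\bm{X}$ has at most $K$ nonzero entries, the event has probability at least $1-\eta$.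
   Context: Vectors $\bm{X}\in\mathbb{R}^{N^d}$ are multi-indexed by $\{1,\dots,N\}^d$. The discrete gradient $D\bm{X}$ is the concatenation of the directional finite differences: its entries are $X_{\bm{k}+\bm{e}_i}-X_{\bm{k}}$ for $i=1,\dots,d$ and all $\bm{k}\in\{1,\dots,N\}^d$ with $k_i\le N-1$, where $\bm{e}_i$ is the $i$-th standard unit vector. $\|D\bm{X}\|_1$ (the sum of absolute values of all these entries) is the anisotropic total variation of $\bm{X}$. *)

theory Defs
  imports "HOL-Probability.Probability"
begin

text \<open>Multi-indices \<open>{1,\<dots>,N}^d\<close>, represented as extensional functions on \<open>{1..d}\<close>.\<close>

type_synonym multi_index = "nat \<Rightarrow> nat"

definition grid :: "nat \<Rightarrow> nat \<Rightarrow> multi_index set" where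
  "grid d N = ({1..d} \<rightarrow>\<^sub>E {1..N})"

text \<open>The space of vectors indexed by the grid. Being extensional, two of them are equal
  as functions iff they agree on the grid.\<close>

definition grid_vectors :: "nat \<Rightarrow> nat \<Rightarrow> (multi_index \<Rightarrow> real) set" where
  "grid_vectors d N = (grid d N \<rightarrow>\<^sub>E UNIV)"

text \<open>The entries of the discrete gradient are indexed by pairs \<open>(i, k)\<close> of a direction and
  a base point at which the forward difference in that direction stays inside the grid.\<close>

definition grad_index :: "nat \<Rightarrow> nat \<Rightarrow> (nat \<times> multi_index) set" where
  "grad_index d N = {(i, k). i \<in> {1..d} \<and> k \<in> grid d N \<and> k i \<le> N - 1}"

definition discrete_gradient ::
    "nat \<Rightarrow> nat \<Rightarrow> (multi_index \<Rightarrow> real) \<Rightarrow> nat \<times> multi_index \<Rightarrow> real" where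
  "discrete_gradient d N X = (\<lambda>(i, k) \<in> grad_index d N. X (k(i := k i + 1)) - X k)"

definition total_variation :: "nat \<Rightarrow> nat \<Rightarrow> (multi_index \<Rightarrow> real) \<Rightarrow> real" where
  "total_variation d N X = (\<Sum>p \<in> grad_index d N. \<bar>discrete_gradient d N X p\<bar>)"

definition gradient_sparsity :: "nat \<Rightarrow> nat \<Rightarrow> (multi_index \<Rightarrow> real) \<Rightarrow> nat" where
  "gradient_sparsity d N X = card {p \<in> grad_index d N. discrete_gradient d N X p \<noteq> 0}"

text \<open>A matrix with rows \<open>{1..M}\<close> and columns indexed by the grid.\<close>

type_synonym grid_matrix = "nat \<times> multi_index \<Rightarrow> real"

definition apply_matrix ::
    "nat \<Rightarrow> nat \<Rightarrow> nat \<Rightarrow> grid_matrix \<Rightarrow> (multi_index \<Rightarrow> real) \<Rightarrow> nat \<Rightarrow> real" where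
  "apply_matrix d N M A X = (\<lambda>m \<in> {1..M}. \<Sum>k \<in> grid d N. A (m, k) * X k)"

definition tv_minimizers ::
    "nat \<Rightarrow> nat \<Rightarrow> nat \<Rightarrow> grid_matrix \<Rightarrow> (nat \<Rightarrow> real) \<Rightarrow> (multi_index \<Rightarrow> real) set" where
  "tv_minimizers d N M A Y =
     {U. is_arg_min (total_variation d N) (\<lambda>V. V \<in> grid_vectors d N \<and> Y = apply_matrix d N M A V) U}"

text \<open>The law of a random matrix with independent standard normal entries. Working with the law
  rather than with a random variable on an unspecified probability space keeps the constants and
  thresholds below independent of such a space (in particular of its type); the two
  views are connected by the lemma that follows.\<close>

definition gaussian_matrix :: "nat \<Rightarrow> nat \<Rightarrow> nat \<Rightarrow> grid_matrix measure" where
  "gaussian_matrix d N M =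
     (\<Pi>\<^sub>M p \<in> {1..M} \<times> grid d N. density lborel (\<lambda>x. ennreal (std_normal_density x)))"

lemma distr_iid_normal_entries:
  assumes "prob_space P" "M \<ge> 1" "N \<ge> 1"
    and "prob_space.indep_vars P (\<lambda>_. borel) A ({1..M} \<times> grid d N)"
    and "\<And>p. p \<in> {1..M} \<times> grid d N \<Longrightarrow> distributed P lborel (A p) (\<lambda>x. ennreal (std_normal_density x))"
  shows "distr P (\<Pi>\<^sub>M p \<in> {1..M} \<times> grid d N. borel) (\<lambda>\<omega>. \<lambda>p \<in> {1..M} \<times> grid d N. A p \<omega>)
           = gaussian_matrix d N M"
proof -
  interpret prob_space P by fact
  let ?I = "{1..M} \<times> grid d N"
  have "?I \<noteq> {}"
    using assms(2,3) by (auto simp: grid_def PiE_eq_empty_iff)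
  moreover have "random_variable borel (A p)" if "p \<in> ?I" for p
    using distributed_measurable[OF assms(5)[OF that]] by simp
  ultimately have "distr P (\<Pi>\<^sub>M p \<in> ?I. borel) (\<lambda>\<omega>. \<lambda>p \<in> ?I. A p \<omega>)
      = (\<Pi>\<^sub>M p \<in> ?I. distr P borel (A p))"
    using assms(4) by (subst (asm) indep_vars_iff_distr_eq_PiM') auto
  also have "\<dots> = gaussian_matrix d N M"
    unfolding gaussian_matrix_def
  proof (rule PiM_cong)
    fix p assume "p \<in> ?I"
    have "distr P borel (A p) = distr P lborel (A p)"
      by (rule distr_cong) auto
    also have "\<dots> = density lborel (\<lambda>x. ennreal (std_normal_density x))"
      using assms(5)[OF \<open>p \<in> ?I\<close>] by (rule distributed_distr_eq_density)
    finally show "distr P borel (A p) = density lborel (\<lambda>x. ennreal (std_normal_density x))" .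
  qed simp
  finally show ?thesis .
qed

end

theory Submission
  imports Defs
begin

text \<open>
  Recursively halving the longest side of the grid writes every vector \<open>H\<close> as a combination of
  \<open>\<ell>\<^sup>2\<close>-normalised indicators of boxes. Averaging the fundamental theorem of calculus over the lines in
  the split direction bounds the coefficients created by splitting a box \<open>Q\<close> by a multiple of
  \<open>card Q powr (1 / d - 1 / 2)\<close> times the variation of \<open>H\<close> inside \<open>Q\<close>; over all generations the
  coefficients sum to at most \<open>C log N\<close> (for \<open>d = 2\<close>) or \<open>C\<close> (for \<open>d > 2\<close>) times \<open>\<parallel>D H\<parallel>\<^sub>1\<close>.

  If \<open>X\<close> is \<open>K\<close>-gradient-sparse and \<open>H\<close> does not increase the variation at \<open>X\<close>, then \<open>\<parallel>D H\<parallel>\<^sub>1\<close> is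
  at most a multiple of \<open>sqrt K \<parallel>H\<parallel>\<^sub>2\<close>, so a normalised \<open>H\<close> lies in \<open>R\<close> times the absolutely convex hull of
  the atoms, with \<open>R\<^sup>2\<close> of order \<open>K log\<^sup>2 N\<close> or \<open>K\<close>. By Maurey's empirical method, \<open>H\<close> is
  approximated by an average of \<open>k\<close> scaled atoms, \<open>k\<close> of order \<open>R\<^sup>2\<close>, simultaneously in \<open>\<parallel>\<cdot>\<parallel>\<^sub>2\<close> and in
  \<open>\<parallel>A \<cdot>\<parallel>\<^sub>2\<close>. There are only \<open>N powr O(k)\<close> such averages, so chi-square tail bounds and a union bound
  show that \<open>A\<close> is bounded below on all of them, and \<open>A H = 0\<close> is impossible.
\<close>

section \<open>Maurey's empirical method\<close>

text \<open>The indices are chosen greedily, one at a time. Drawing the next one with law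
  \<open>p\<close> adds in expectation at most the variance of \<open>u\<close>, hence at most
  \<open>b\<close>, to the squared error, so some choice does no worse than the expectation.\<close>

lemma maurey:
  fixes u :: "'i \<Rightarrow> 'l \<Rightarrow> real" and p :: "'i \<Rightarrow> real"
  assumes "finite I" and p: "\<And>i. i \<in> I \<Longrightarrow> p i \<ge> 0" "sum p I = 1"
    and b: "\<And>i. i \<in> I \<Longrightarrow> (\<Sum>l\<in>\<Lambda>. (u i l)\<^sup>2) \<le> b"
  shows "\<exists>s \<in> {..<k} \<rightarrow>\<^sub>E I.
    (\<Sum>l\<in>\<Lambda>. (real k * (\<Sum>i\<in>I. p i * u i l) - (\<Sum>j<k. u (s j) l))\<^sup>2) \<le> real k * b"
proof (induction k)
  case 0
  show ?case by auto
next
  case (Suc k)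
  then obtain s where s: "s \<in> {..<k} \<rightarrow>\<^sub>E I"
    and le: "(\<Sum>l\<in>\<Lambda>. (real k * (\<Sum>i\<in>I. p i * u i l) - (\<Sum>j<k. u (s j) l))\<^sup>2) \<le> real k * b"
    by blast
  define h where "h l = (\<Sum>i\<in>I. p i * u i l)" for l
  define w where "w l = real k * h l - (\<Sum>j<k. u (s j) l)" for l
  define f where "f i = (\<Sum>l\<in>\<Lambda>. (w l + (h l - u i l))\<^sup>2)" for i
  \<comment> \<open>\<open>h l\<close> is the \<open>p\<close>-mean of \<open>u i l\<close>, so the
    cross term with \<open>w l\<close> vanishes and only the variance remains. The term
    \<open>- (h l)\<^sup>2\<close> is dropped afterwards.\<close>
  have pt: "(\<Sum>i\<in>I. p i * (w l + (h l - u i l))\<^sup>2) = (w l)\<^sup>2 - (h l)\<^sup>2 + (\<Sum>i\<in>I. p i * (u i l)\<^sup>2)" for l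
  proof -
    have "(\<Sum>i\<in>I. p i * (w l + (h l - u i l))\<^sup>2)
        = (\<Sum>i\<in>I. (w l + h l)\<^sup>2 * p i - 2 * (w l + h l) * (p i * u i l) + p i * (u i l)\<^sup>2)"
      by (intro sum.cong refl) (simp add: power2_eq_square algebra_simps)
    also have "\<dots> = (w l + h l)\<^sup>2 * sum p I - 2 * (w l + h l) * h l + (\<Sum>i\<in>I. p i * (u i l)\<^sup>2)"
      by (simp add: sum.distrib sum_subtractf sum_distrib_left h_def)
    finally show ?thesis
      using p(2) by (simp add: power2_eq_square algebra_simps)
  qed
  have "(\<Sum>i\<in>I. p i * f i) = (\<Sum>l\<in>\<Lambda>. \<Sum>i\<in>I. p i * (w l + (h l - u i l))\<^sup>2)"
    unfolding f_def sum_distrib_left by (rule sum.swap)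
  also have "\<dots> \<le> (\<Sum>l\<in>\<Lambda>. (w l)\<^sup>2 + (\<Sum>i\<in>I. p i * (u i l)\<^sup>2))"
    by (intro sum_mono) (simp add: pt)
  also have "\<dots> = (\<Sum>l\<in>\<Lambda>. (w l)\<^sup>2) + (\<Sum>i\<in>I. p i * (\<Sum>l\<in>\<Lambda>. (u i l)\<^sup>2))"
    by (simp add: sum.distrib sum_distrib_left sum.swap[of _ \<Lambda> I])
  also have "\<dots> \<le> real k * b + (\<Sum>i\<in>I. p i * b)"
    using le by (intro add_mono sum_mono mult_left_mono b p) (auto simp: w_def h_def)
  also have "\<dots> = real (Suc k) * b"
    using p(2) by (simp add: sum_distrib_right[symmetric] distrib_right)
  finally have avg: "(\<Sum>i\<in>I. p i * f i) \<le> real (Suc k) * b" .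
  \<comment> \<open>A weighted average is at least the least value. Weights may be zero, so the
    contradiction is that all of them would have to vanish.\<close>
  have "\<exists>i\<in>I. f i \<le> real (Suc k) * b"
  proof (rule ccontr)
    assume "\<not> ?thesis"
    then have gt: "f i > real (Suc k) * b" if "i \<in> I" for i
      using that by (auto simp: not_le)
    have "(\<Sum>i\<in>I. p i * (f i - real (Suc k) * b)) = (\<Sum>i\<in>I. p i * f i) - real (Suc k) * b"
      using p(2) by (simp add: right_diff_distrib sum_subtractf sum_distrib_right[symmetric])
    moreover have nn: "p i * (f i - real (Suc k) * b) \<ge> 0" if "i \<in> I" for i
      using gt[OF that] p(1)[OF that] by simp
    ultimately have "(\<Sum>i\<in>I. p i * (f i - real (Suc k) * b)) = 0"
      using avg sum_nonneg[of I "\<lambda>i. p i * (f i - real (Suc k) * b)"] by force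
    then have "p i = 0" if "i \<in> I" for i
      using sum_nonneg_eq_0_iff[OF assms(1) nn] gt that by force
    then show False using p(2) by simp
  qed
  then obtain i where i: "i \<in> I" "f i \<le> real (Suc k) * b" by blast
  define s' where "s' = s(k := i)"
  have "s' \<in> {..<Suc k} \<rightarrow>\<^sub>E I"
    using s i(1) unfolding s'_def by (auto simp: PiE_def extensional_def Pi_def less_Suc_eq)
  moreover have "real (Suc k) * (\<Sum>i\<in>I. p i * u i l) - (\<Sum>j<Suc k. u (s' j) l) = w l + (h l - u i l)" for l
    unfolding w_def h_def[symmetric] s'_def by (simp add: algebra_simps)
  ultimately show ?case
    using i(2) unfolding f_def by (intro bexI[of _ s']) auto
qed

section \<open>Gaussian matrices\<close>

text \<open>Independence is read off the joint law: on a product space the coordinates jointly form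
  the identity map, and the marginals are the factors.\<close>

lemma indep_vars_PiM_coordinates:
  assumes "\<And>i. i \<in> I \<Longrightarrow> prob_space (N i)" "I \<noteq> {}" "finite I"
  shows "prob_space.indep_vars (PiM I N) N (\<lambda>i x. x i) I"
proof -
  have ps: "prob_space (PiM I N)" by (intro prob_space_PiM assms)
  then interpret P: prob_space "PiM I N" .
  have "distr (PiM I N) (PiM I N) (\<lambda>x. \<lambda>i\<in>I. x i) = distr (PiM I N) (PiM I N) (\<lambda>x. x)"
    by (rule distr_cong) (auto simp: space_PiM PiE_def extensional_def restrict_def fun_eq_iff)
  also have "\<dots> = PiM I (\<lambda>i. distr (PiM I N) (N i) (\<lambda>x. x i))"
    unfolding distr_id by (intro PiM_cong refl) (simp add: distr_PiM_component assms)
  finally show ?thesis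
    by (subst P.indep_vars_iff_distr_eq_PiM') (use assms in auto)
qed

section \<open>Chi-square moment generating function and tails\<close>

abbreviation std_normal :: "real measure" where
  "std_normal \<equiv> density lborel (\<lambda>x. ennreal (std_normal_density x))"

text \<open>Tilting by \<open>exp (l * x\<^sup>2)\<close> turns the standard normal density into a
  multiple of the centred one with variance \<open>1 / (1 - 2 * l)\<close>. The value is the moment
  generating function of a chi-square variable with one degree of freedom.\<close>

lemma nn_integral_exp_square_std_normal:
  fixes l :: real
  assumes "l < 1 / 2"
  shows "(\<integral>\<^sup>+x. ennreal (std_normal_density x) * ennreal (exp (l * x\<^sup>2)) \<partial>lborel)
    = ennreal (1 / sqrt (1 - 2 * l))"
proof -
  define \<sigma> where "\<sigma> = 1 / sqrt (1 - 2 * l)"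
  have s: "\<sigma> > 0" "\<sigma>\<^sup>2 = 1 / (1 - 2 * l)"
    using assms by (auto simp: \<sigma>_def power_divide)
  have eq: "std_normal_density x * exp (l * x\<^sup>2) = \<sigma> * normal_density 0 \<sigma> x" for x
  proof -
    have "- x\<^sup>2 / (2 * \<sigma>\<^sup>2) = - x\<^sup>2 / 2 + l * x\<^sup>2"
      unfolding s(2) using assms by (simp add: algebra_simps diff_divide_distrib)
    then show ?thesis
      using s(1) by (simp add: normal_density_def real_sqrt_mult mult_exp_exp)
  qed
  have "(\<integral>\<^sup>+x. ennreal (std_normal_density x) * ennreal (exp (l * x\<^sup>2)) \<partial>lborel)
      = (\<integral>\<^sup>+x. ennreal \<sigma> * ennreal (normal_density 0 \<sigma> x) \<partial>lborel)"
    using s(1) by (intro nn_integral_cong) (simp add: ennreal_mult[symmetric] eq)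
  also have "\<dots> = ennreal \<sigma> * (\<integral>\<^sup>+x. ennreal (normal_density 0 \<sigma> x) \<partial>lborel)"
    by (rule nn_integral_cmult) simp
  also have "(\<integral>\<^sup>+x. ennreal (normal_density 0 \<sigma> x) \<partial>lborel) = ennreal 1"
    using s(1) by (subst nn_integral_eq_integral) auto
  finally show ?thesis by (simp add: \<sigma>_def)
qed

text \<open>For a unit vector \<open>y\<close> the entries of the image are independent standard
  normals, one per row, so the squared norm is chi-square with \<open>card R\<close> degrees of
  freedom.\<close>

lemma nn_integral_exp_sum_squares_gaussian:
  fixes y :: "'k \<Rightarrow> real" and l :: real and R :: "'m set"
  assumes "finite R" "R \<noteq> {}" "finite G" and y: "(\<Sum>k\<in>G. (y k)\<^sup>2) = 1" and "l < 1 / 2"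
  defines "P \<equiv> (\<Pi>\<^sub>M p \<in> R \<times> G. std_normal)"
  shows "(\<integral>\<^sup>+A. ennreal (exp (l * (\<Sum>m\<in>R. (\<Sum>k\<in>G. A (m, k) * y k)\<^sup>2))) \<partial>P)
    = ennreal ((1 / sqrt (1 - 2 * l)) ^ card R)"
proof -
  have Gne: "G \<noteq> {}" using y by auto
  have psn: "prob_space std_normal"
    using prob_space_normal_density[of 1 0] by simp
  interpret P: prob_space P
    unfolding P_def by (intro prob_space_PiM psn)
  have comp: "P.indep_vars (\<lambda>_. std_normal) (\<lambda>p A. A p) (R \<times> G)"
    unfolding P_def using assms(1-3) Gne by (intro indep_vars_PiM_coordinates psn) auto
  have meas[measurable]: "(\<lambda>A. A p) \<in> borel_measurable P" if "p \<in> R \<times> G" for p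
  proof -
    have "(\<lambda>A. A p) \<in> measurable P std_normal"
      using that by (simp add: P_def)
    then show ?thesis by simp
  qed
  define Z where "Z m A = (\<Sum>k\<in>G. A (m, k) * y k)" for m and A :: "'m \<times> 'k \<Rightarrow> real"
  have Z_meas: "(\<lambda>A. \<Sum>k\<in>G. A (m, k) * y k) \<in> borel_measurable (\<Pi>\<^sub>M p \<in> {m} \<times> G. std_normal)" for m
    by (intro borel_measurable_sum borel_measurable_times borel_measurable_const)
       (use measurable_component_singleton[of "(m, _)" "{m} \<times> G" "\<lambda>_. std_normal"] in simp)
  \<comment> \<open>Different rows depend on disjoint blocks of matrix entries.\<close>
  have Z_indep: "P.indep_vars (\<lambda>_. borel) Z R"
  proof -
    have "P.indep_vars (\<lambda>m. PiM ({m} \<times> G) (\<lambda>_. std_normal))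
        (\<lambda>m A. restrict (\<lambda>p. A p) ({m} \<times> G)) R"
      by (intro P.indep_vars_restrict[OF comp]) (auto simp: disjoint_family_on_def)
    then have "P.indep_vars (\<lambda>_. borel)
        (\<lambda>m A. \<Sum>k\<in>G. restrict (\<lambda>p. A p) ({m} \<times> G) (m, k) * y k) R"
      by (rule P.indep_vars_compose2) (rule Z_meas)
    then show ?thesis unfolding Z_def
      by (rule P.indep_vars_cong[THEN iffD1, rotated -1]) (auto simp: fun_eq_iff)
  qed
  have Z_dist: "distributed P lborel (Z m) (\<lambda>x. ennreal (std_normal_density x))" if m: "m \<in> R" for m
  proof -
    \<comment> \<open>Zero entries of \<open>y\<close> are removed because they would give
      degenerate normals of standard deviation 0.\<close>
    define G' where "G' = {k \<in> G. y k \<noteq> 0}"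
    have G': "finite G'" "G' \<subseteq> G" using assms(3) by (auto simp: G'_def)
    have y': "(\<Sum>k\<in>G'. (y k)\<^sup>2) = 1"
      unfolding y[symmetric] G'_def using assms(3) by (intro sum.mono_neutral_left) auto
    then have "G' \<noteq> {}" by auto
    have single: "distributed P lborel (\<lambda>A. A (m, k)) (\<lambda>x. ennreal (std_normal_density x))" if "k \<in> G'" for k
    proof -
      have "distr P lborel (\<lambda>A. A (m, k)) = distr P std_normal (\<lambda>A. A (m, k))"
        by (rule distr_cong) auto
      also have "\<dots> = std_normal"
        unfolding P_def using m that G' psn by (intro distr_PiM_component) auto
      finally show ?thesis
        unfolding distributed_def using m that G' by auto
    qed
    have "distributed P lborel (\<lambda>A. 0 + y k * A (m, k)) (normal_density (0 + y k * 0) (\<bar>y k\<bar> * 1))"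
      if "k \<in> G'" for k
      using that by (intro P.normal_density_affine single) (auto simp: G'_def)
    then have each: "distributed P lborel (\<lambda>A. A (m, k) * y k) (normal_density 0 \<bar>y k\<bar>)"
      if "k \<in> G'" for k
      using that by (simp add: mult.commute)
    have "P.indep_vars (\<lambda>k. PiM {(m, k)} (\<lambda>_. std_normal)) (\<lambda>k A. restrict (\<lambda>p. A p) {(m, k)}) G'"
      using G' m by (intro P.indep_vars_restrict[OF comp]) (auto simp: disjoint_family_on_def)
    then have "P.indep_vars (\<lambda>_. borel) (\<lambda>k A. restrict (\<lambda>p. A p) {(m, k)} (m, k) * y k) G'"
    proof (rule P.indep_vars_compose2)
      fix k
      show "(\<lambda>A. A (m, k) * y k) \<in> borel_measurable (\<Pi>\<^sub>M p \<in> {(m, k)}. std_normal)"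
        using measurable_component_singleton[of "(m, k)" "{(m, k)}" "\<lambda>_. std_normal"] by simp
    qed
    then have ind: "P.indep_vars (\<lambda>_. borel) (\<lambda>k A. A (m, k) * y k) G'"
      by simp
    have "distributed P lborel (\<lambda>A. \<Sum>k\<in>G'. A (m, k) * y k)
        (normal_density (\<Sum>k\<in>G'. 0) (sqrt (\<Sum>k\<in>G'. \<bar>y k\<bar>\<^sup>2)))"
      using G' \<open>G' \<noteq> {}\<close> each by (intro P.sum_indep_normal ind) (auto simp: G'_def)
    moreover have "(\<lambda>A. \<Sum>k\<in>G'. A (m, k) * y k) = Z m"
      unfolding Z_def G'_def using assms(3) by (intro ext sum.mono_neutral_left) auto
    ultimately show ?thesis using y' by simp
  qed
  have mgf: "(\<integral>\<^sup>+A. ennreal (exp (l * (Z m A)\<^sup>2)) \<partial>P) = ennreal (1 / sqrt (1 - 2 * l))" if "m \<in> R" for m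
    using distributed_nn_integral[OF Z_dist[OF that], of "\<lambda>x. ennreal (exp (l * x\<^sup>2))"]
      nn_integral_exp_square_std_normal[OF assms(5)] by simp
  have "(\<integral>\<^sup>+A. ennreal (exp (l * (\<Sum>m\<in>R. (\<Sum>k\<in>G. A (m, k) * y k)\<^sup>2))) \<partial>P)
      = (\<integral>\<^sup>+A. (\<Prod>m\<in>R. ennreal (exp (l * (Z m A)\<^sup>2))) \<partial>P)"
    by (intro nn_integral_cong) (simp add: Z_def sum_distrib_left exp_sum assms(1) prod_ennreal)
  also have "\<dots> = (\<Prod>m\<in>R. \<integral>\<^sup>+A. ennreal (exp (l * (Z m A)\<^sup>2)) \<partial>P)"
    by (intro P.indep_vars_nn_integral assms(1) P.indep_vars_compose2[OF Z_indep]) auto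
  also have "\<dots> = ennreal ((1 / sqrt (1 - 2 * l)) ^ card R)"
    using assms(5) by (simp add: mgf ennreal_power)
  finally show ?thesis .
qed

lemma borel_measurable_image_norm [measurable]:
  fixes y :: "'k \<Rightarrow> real"
  shows "(\<lambda>A. \<Sum>m\<in>R. (\<Sum>k\<in>G. A (m, k) * y k)\<^sup>2) \<in> borel_measurable (\<Pi>\<^sub>M p \<in> R \<times> G. std_normal)"
proof -
  have "(\<lambda>A. A p) \<in> borel_measurable (\<Pi>\<^sub>M p \<in> R \<times> G. std_normal)" if "p \<in> R \<times> G" for p
    using measurable_component_singleton[OF that, of "\<lambda>_. std_normal"] by simp
  then show ?thesis
    by (intro borel_measurable_sum borel_measurable_power borel_measurable_times borel_measurable_const) auto
qed

text \<open>After scaling \<open>y\<close> to unit length, both tails follow from the exponential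
  Markov inequality. The thresholds 1/16 and 4 are generous enough that each factor per row stays
  below 9/10.\<close>

lemma gaussian_image_norm_tails:
  fixes y :: "'k \<Rightarrow> real" and R :: "'m set"
  assumes "finite R" "R \<noteq> {}" "finite G" and y: "(\<Sum>k\<in>G. (y k)\<^sup>2) > 0"
  defines "P \<equiv> (\<Pi>\<^sub>M p \<in> R \<times> G. std_normal)"
  shows "measure P {A \<in> space P. (\<Sum>m\<in>R. (\<Sum>k\<in>G. A (m, k) * y k)\<^sup>2)
           \<le> real (card R) / 16 * (\<Sum>k\<in>G. (y k)\<^sup>2)} \<le> (9 / 10) ^ card R"
    and "measure P {A \<in> space P. (\<Sum>m\<in>R. (\<Sum>k\<in>G. A (m, k) * y k)\<^sup>2)
           \<ge> 4 * real (card R) * (\<Sum>k\<in>G. (y k)\<^sup>2)} \<le> (9 / 10) ^ card R"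
proof -
  define r where "r = sqrt (\<Sum>k\<in>G. (y k)\<^sup>2)"
  define z where "z k = y k / r" for k
  have r: "r > 0" "r\<^sup>2 = (\<Sum>k\<in>G. (y k)\<^sup>2)" using y by (auto simp: r_def)
  have z: "(\<Sum>k\<in>G. (z k)\<^sup>2) = 1"
    using r y by (simp add: z_def power_divide sum_divide_distrib[symmetric])
  define F where "F A = (\<Sum>m\<in>R. (\<Sum>k\<in>G. A (m, k) * z k)\<^sup>2)" for A :: "'m \<times> 'k \<Rightarrow> real"
  have F: "(\<Sum>m\<in>R. (\<Sum>k\<in>G. A (m, k) * y k)\<^sup>2) = F A * r\<^sup>2" for A
    unfolding F_def sum_distrib_right power_mult_distrib[symmetric]
    using r(1) by (simp add: z_def)
  have psn: "prob_space std_normal"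
    using prob_space_normal_density[of 1 0] by simp
  interpret P: prob_space P
    unfolding P_def by (intro prob_space_PiM psn)
  have [measurable]: "F \<in> borel_measurable P"
    unfolding F_def[abs_def] P_def by (rule borel_measurable_image_norm)
  have mgf: "(\<integral>\<^sup>+A. ennreal (exp (l * F A)) \<partial>P) = ennreal ((1 / sqrt (1 - 2 * l)) ^ card R)"
    if "l < 1 / 2" for l
    unfolding P_def F_def using assms(1-3) z that by (intro nn_integral_exp_sum_squares_gaussian) auto
  have c1: "exp (3 / 32) * (1 / 2) \<le> (9 / 10 :: real)"
    using exp_bound[of "3 / 32"] by (simp add: power2_eq_square)
  have c2: "exp (- 1) * sqrt 2 \<le> (9 / 10 :: real)"
  proof -
    have "exp (- 1) * sqrt 2 \<le> (1 / 2) * (3 / 2 :: real)"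
      using exp_ge_add_one_self[of 1]
      by (intro mult_mono real_le_lsqrt) (auto simp: exp_minus field_simps power2_eq_square)
    then show ?thesis by simp
  qed
  let ?n = "card R"
  \<comment> \<open>The exponent \<open>- 3 / 2\<close> makes the moment generating function
    \<open>1 / sqrt 4\<close> per row, against a factor \<open>exp (3 / 32)\<close> from the
    threshold.\<close>
  have "emeasure P {A \<in> space P. F A \<le> real ?n / 16}
      \<le> ennreal (exp (3 / 2 * (real ?n / 16))) * (\<integral>\<^sup>+A. ennreal (exp (- (3 / 2) * F A)) * indicator (space P) A \<partial>P)"
    by (rule Chernoff_ineq_nn_integral_le) auto
  also have "(\<integral>\<^sup>+A. ennreal (exp (- (3 / 2) * F A)) * indicator (space P) A \<partial>P)
      = (\<integral>\<^sup>+A. ennreal (exp (- (3 / 2) * F A)) \<partial>P)"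
    by (intro nn_integral_cong) simp
  also have "\<dots> = ennreal ((1 / 2) ^ ?n)"
    by (subst mgf) auto
  also have "ennreal (exp (3 / 2 * (real ?n / 16))) * \<dots> = ennreal ((exp (3 / 32) * (1 / 2)) ^ ?n)"
    by (simp add: ennreal_mult[symmetric] power_mult_distrib power_divide exp_of_nat_mult[symmetric])
  also have "\<dots> \<le> ennreal ((9 / 10) ^ ?n)"
    by (intro ennreal_leI power_mono c1) auto
  finally show "measure P {A \<in> space P. (\<Sum>m\<in>R. (\<Sum>k\<in>G. A (m, k) * y k)\<^sup>2)
           \<le> real ?n / 16 * (\<Sum>k\<in>G. (y k)\<^sup>2)} \<le> (9 / 10) ^ ?n"
    using r by (simp add: F r(2)[symmetric] P.emeasure_eq_measure)
  \<comment> \<open>The exponent \<open>1 / 4\<close> gives \<open>sqrt 2\<close> per row, against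
    \<open>exp (- 1)\<close> from the threshold.\<close>
  have "emeasure P {A \<in> space P. F A \<ge> 4 * real ?n}
      \<le> ennreal (exp (- (1 / 4) * (4 * real ?n))) * (\<integral>\<^sup>+A. ennreal (exp (1 / 4 * F A)) * indicator (space P) A \<partial>P)"
    by (rule Chernoff_ineq_nn_integral_ge) auto
  also have "(\<integral>\<^sup>+A. ennreal (exp (1 / 4 * F A)) * indicator (space P) A \<partial>P)
      = (\<integral>\<^sup>+A. ennreal (exp (1 / 4 * F A)) \<partial>P)"
    by (intro nn_integral_cong) simp
  also have "\<dots> = ennreal (sqrt 2 ^ ?n)"
    by (subst mgf) (auto simp: real_sqrt_divide)
  also have "ennreal (exp (- (1 / 4) * (4 * real ?n))) * \<dots> = ennreal ((exp (- 1) * sqrt 2) ^ ?n)"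
    by (simp add: ennreal_mult[symmetric] power_mult_distrib exp_of_nat_mult[symmetric])
  also have "\<dots> \<le> ennreal ((9 / 10) ^ ?n)"
    by (intro ennreal_leI power_mono c2) auto
  finally show "measure P {A \<in> space P. (\<Sum>m\<in>R. (\<Sum>k\<in>G. A (m, k) * y k)\<^sup>2)
           \<ge> 4 * real ?n * (\<Sum>k\<in>G. (y k)\<^sup>2)} \<le> (9 / 10) ^ ?n"
    using r by (simp add: F r(2)[symmetric] P.emeasure_eq_measure)
qed

section \<open>Measurability of the failure event\<close>

text \<open>Bolzano-Weierstrass on finitely many coordinates, refining the subsequence one
  coordinate at a time.\<close>

lemma pointwise_bounded_convergent_subsequence:
  fixes S :: "nat \<Rightarrow> 'k \<Rightarrow> real"
  assumes "finite G" "\<And>n k. k \<in> G \<Longrightarrow> \<bar>S n k\<bar> \<le> b"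
  shows "\<exists>r l. strict_mono (r :: nat \<Rightarrow> nat) \<and> (\<forall>k\<in>G. (\<lambda>n. S (r n) k) \<longlonglongrightarrow> l k)"
  using assms
proof (induction G)
  case empty
  show ?case by (intro exI[of _ id]) (auto simp: strict_mono_def)
next
  case (insert x G)
  then obtain r l where r: "strict_mono r" and l: "\<And>k. k \<in> G \<Longrightarrow> (\<lambda>n. S (r n) k) \<longlonglongrightarrow> l k"
    by blast
  have "bounded (range (\<lambda>n. S (r n) x))"
    using insert.prems by (auto simp: bounded_iff intro!: exI[of _ b])
  then obtain y q where q: "strict_mono q" and y: "((\<lambda>n. S (r n) x) \<circ> q) \<longlonglongrightarrow> y"
    using bounded_imp_convergent_subsequence by blast
  have "(\<lambda>n. S ((r \<circ> q) n) k) \<longlonglongrightarrow> (l(x := y)) k" if "k \<in> insert x G" for k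
    using LIMSEQ_subseq_LIMSEQ[OF l q, of k] y that insert.hyps by (auto simp: comp_def)
  then show ?case
    using strict_mono_o[OF r q] by blast
qed

text \<open>The uncountable existential quantifier becomes countable by approximating with rational
  vectors; conversely, a limit point of approximate solutions is a solution.\<close>

lemma kernel_event_measurable:
  fixes f :: "('k \<Rightarrow> real) \<Rightarrow> real" and R :: "'m set" and P :: "('m \<times> 'k \<Rightarrow> real) measure"
  assumes fin: "finite R" "finite G"
    and meas: "\<And>p. p \<in> R \<times> G \<Longrightarrow> (\<lambda>A. A p) \<in> borel_measurable P"
    and cont: "\<And>S l. (\<And>k. k \<in> G \<Longrightarrow> (\<lambda>n. S n k) \<longlonglongrightarrow> l k) \<Longrightarrow> (\<lambda>n. f (S n)) \<longlonglongrightarrow> f l"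
  shows "{A \<in> space P. \<exists>H \<in> G \<rightarrow>\<^sub>E UNIV. (\<exists>k\<in>G. H k \<noteq> 0) \<and>
            (\<forall>m\<in>R. (\<Sum>k\<in>G. A (m, k) * H k) = 0) \<and> f H \<le> c} \<in> sets P"
proof -
  \<comment> \<open>\<open>n\<close> fixes a compact shell: the lower bound keeps limits away from
    0, the upper bound gives compactness. \<open>j\<close> is the tolerance, and rational entries
    make the set countable.\<close>
  define D where "D n j = {H \<in> G \<rightarrow>\<^sub>E \<rat>. inverse (real (Suc n)) \<le> (\<Sum>k\<in>G. \<bar>H k\<bar>) \<and>
      (\<Sum>k\<in>G. \<bar>H k\<bar>) \<le> real (Suc n) \<and> f H \<le> c + inverse (real (Suc j))}" for n j
  have cD: "countable (D n j)" for n j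
    by (rule countable_subset[of _ "G \<rightarrow>\<^sub>E \<rat>"]) (auto simp: D_def intro!: countable_PiE fin countable_rat)
  have iff: "(\<exists>H \<in> G \<rightarrow>\<^sub>E UNIV. (\<exists>k\<in>G. H k \<noteq> 0) \<and> (\<forall>m\<in>R. (\<Sum>k\<in>G. A (m, k) * H k) = 0) \<and> f H \<le> c)
    \<longleftrightarrow> (\<exists>n. \<forall>j. \<exists>H \<in> D n j. \<forall>m\<in>R. \<bar>\<Sum>k\<in>G. A (m, k) * H k\<bar> \<le> inverse (real (Suc j)))"
    (is "?L \<longleftrightarrow> ?Q") for A :: "'m \<times> 'k \<Rightarrow> real"
  proof
    assume ?L
    then obtain H k0 where H: "k0 \<in> G" "H k0 \<noteq> 0" "\<And>m. m \<in> R \<Longrightarrow> (\<Sum>k\<in>G. A (m, k) * H k) = 0" "f H \<le> c"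
      by blast
    have pos: "(\<Sum>k\<in>G. \<bar>H k\<bar>) > 0"
      using H(1,2) fin by (intro sum_pos2[of G k0]) auto
    obtain n1 where n1: "inverse (real (Suc n1)) < (\<Sum>k\<in>G. \<bar>H k\<bar>)"
      using reals_Archimedean[OF pos] by auto
    obtain n2 where n2: "(\<Sum>k\<in>G. \<bar>H k\<bar>) < real n2"
      using reals_Archimedean2 by blast
    define n where "n = max n1 n2"
    have "inverse (real (Suc n)) \<le> inverse (real (Suc n1))"
      by (intro le_imp_inverse_le) (auto simp: n_def)
    then have "inverse (real (Suc n)) < (\<Sum>k\<in>G. \<bar>H k\<bar>)" using n1 by (rule le_less_trans)
    moreover have "(\<Sum>k\<in>G. \<bar>H k\<bar>) < real (Suc n)"
      using n2 unfolding n_def by linarith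
    ultimately have n: "inverse (real (Suc n)) < (\<Sum>k\<in>G. \<bar>H k\<bar>)" "(\<Sum>k\<in>G. \<bar>H k\<bar>) < real (Suc n)" .
    \<comment> \<open>Rational vectors converging to \<open>H\<close> eventually lie in
      \<open>D n j\<close>, since the bounds for \<open>n\<close> hold strictly at \<open>H\<close>
      and the bound on \<open>f\<close> has slack.\<close>
    have "\<exists>q\<in>\<rat>. \<bar>q - H k\<bar> < inverse (real (Suc t))" for k t
    proof -
      obtain q where "q \<in> \<rat>" "H k < q" "q < H k + inverse (real (Suc t))"
        using Rats_dense_in_real[of "H k" "H k + inverse (real (Suc t))"] by auto
      then show ?thesis by (intro bexI[of _ q]) auto
    qed
    then have "\<forall>t k. \<exists>q. q \<in> \<rat> \<and> \<bar>q - H k\<bar> < inverse (real (Suc t))" by blast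
    then obtain q where "\<forall>t k. q t k \<in> \<rat> \<and> \<bar>q t k - H k\<bar> < inverse (real (Suc t))"
      by metis
    then have q: "q t k \<in> \<rat>" "\<bar>q t k - H k\<bar> < inverse (real (Suc t))" for t k by auto
    define S where "S t = restrict (q t) G" for t
    have SG: "S t \<in> G \<rightarrow>\<^sub>E \<rat>" for t using q(1) by (auto simp: S_def)
    have lim: "(\<lambda>t. S t k) \<longlonglongrightarrow> H k" if "k \<in> G" for k
    proof -
      have "(\<lambda>t. S t k - H k) \<longlonglongrightarrow> 0"
        by (rule LIMSEQ_norm_0[of _]) (use that q(2)[of _ k] in \<open>auto simp: S_def divide_inverse\<close>)
      then show ?thesis by (simp add: LIM_zero_iff)
    qed
    have lsum: "(\<lambda>t. \<Sum>k\<in>G. \<bar>S t k\<bar>) \<longlonglongrightarrow> (\<Sum>k\<in>G. \<bar>H k\<bar>)"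
      by (intro tendsto_sum tendsto_rabs lim)
    have lA: "(\<lambda>t. \<bar>\<Sum>k\<in>G. A (m, k) * S t k\<bar>) \<longlonglongrightarrow> 0" if "m \<in> R" for m
    proof -
      have "(\<lambda>t. \<bar>\<Sum>k\<in>G. A (m, k) * S t k\<bar>) \<longlonglongrightarrow> \<bar>\<Sum>k\<in>G. A (m, k) * H k\<bar>"
        by (intro tendsto_rabs tendsto_sum tendsto_mult tendsto_const lim)
      then show ?thesis using H(3)[OF that] by simp
    qed
    have "\<exists>H \<in> D n j. \<forall>m\<in>R. \<bar>\<Sum>k\<in>G. A (m, k) * H k\<bar> \<le> inverse (real (Suc j))" for j
    proof -
      have "\<forall>\<^sub>F t in sequentially. inverse (real (Suc n)) < (\<Sum>k\<in>G. \<bar>S t k\<bar>)"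
        using n by (intro order_tendstoD(1)[OF lsum])
      moreover have "\<forall>\<^sub>F t in sequentially. (\<Sum>k\<in>G. \<bar>S t k\<bar>) < real (Suc n)"
        using n by (intro order_tendstoD(2)[OF lsum])
      moreover have "\<forall>\<^sub>F t in sequentially. f (S t) < c + inverse (real (Suc j))"
        using H(4) by (intro order_tendstoD(2)[OF cont[OF lim]]) (auto intro: le_less_trans)
      moreover have "\<forall>\<^sub>F t in sequentially. \<forall>m\<in>R. \<bar>\<Sum>k\<in>G. A (m, k) * S t k\<bar> < inverse (real (Suc j))"
        using fin by (intro eventually_ball_finite ballI order_tendstoD(2)[OF lA]) auto
      ultimately have "\<forall>\<^sub>F t in sequentially. S t \<in> D n j \<and>
          (\<forall>m\<in>R. \<bar>\<Sum>k\<in>G. A (m, k) * S t k\<bar> \<le> inverse (real (Suc j)))"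
        by eventually_elim (use SG in \<open>auto simp: D_def intro: less_imp_le\<close>)
      then show ?thesis
        by (auto dest!: eventually_happens)
    qed
    then show ?Q by blast
  next
    assume ?Q
    then obtain n S where S: "\<And>j. S j \<in> D n j"
        "\<And>j m. m \<in> R \<Longrightarrow> \<bar>\<Sum>k\<in>G. A (m, k) * S j k\<bar> \<le> inverse (real (Suc j))"
      by metis
    have "\<bar>S j k\<bar> \<le> real (Suc n)" if "k \<in> G" for j k
      using S(1)[of j] member_le_sum[of k G "\<lambda>k. \<bar>S j k\<bar>"] that fin by (force simp: D_def)
    then obtain r l where r: "strict_mono (r :: nat \<Rightarrow> nat)"
      and l: "\<And>k. k \<in> G \<Longrightarrow> (\<lambda>j. S (r j) k) \<longlonglongrightarrow> l k"
      using pointwise_bounded_convergent_subsequence[of G S "real (Suc n)"] fin by blast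
    define H where "H = restrict l G"
    have lim: "(\<lambda>j. S (r j) k) \<longlonglongrightarrow> H k" if "k \<in> G" for k
      using l[OF that] that by (simp add: H_def)
    have inv: "(\<lambda>j. inverse (real (Suc (r j)))) \<longlonglongrightarrow> 0"
      using LIMSEQ_subseq_LIMSEQ[OF LIMSEQ_inverse_real_of_nat r] by (simp add: comp_def)
    \<comment> \<open>The lower bound of the shell survives the limit, which is therefore
      nonzero.\<close>
    have "inverse (real (Suc n)) \<le> (\<Sum>k\<in>G. \<bar>H k\<bar>)"
      by (rule tendsto_lowerbound[of "\<lambda>j. \<Sum>k\<in>G. \<bar>S (r j) k\<bar>" _ sequentially])
         (use S(1) in \<open>auto simp: D_def intro!: tendsto_sum tendsto_rabs lim\<close>)
    then have "(\<Sum>k\<in>G. \<bar>H k\<bar>) \<noteq> 0"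
      by (metis inverse_positive_iff_positive not_less of_nat_0_less_iff zero_less_Suc)
    then have "\<exists>k\<in>G. H k \<noteq> 0"
      by (metis abs_zero sum.neutral)
    moreover have "(\<Sum>k\<in>G. A (m, k) * H k) = 0" if m: "m \<in> R" for m
    proof -
      have "(\<lambda>j. \<bar>\<Sum>k\<in>G. A (m, k) * S (r j) k\<bar>) \<longlonglongrightarrow> \<bar>\<Sum>k\<in>G. A (m, k) * H k\<bar>"
        by (intro tendsto_rabs tendsto_sum tendsto_mult tendsto_const lim)
      from tendsto_le[OF _ inv this] S(2)[OF m] show ?thesis by auto
    qed
    moreover have "f H \<le> c"
    proof -
      have "(\<lambda>j. c + inverse (real (Suc (r j)))) \<longlonglongrightarrow> c + 0"
        by (intro tendsto_add tendsto_const inv)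
      from tendsto_le[OF _ this cont[OF lim]] S(1) show ?thesis by (auto simp: D_def)
    qed
    ultimately show ?L
      by (intro bexI[of _ H]) (auto simp: H_def)
  qed
  have "{A \<in> space P. \<forall>m\<in>R. \<bar>\<Sum>k\<in>G. A (m, k) * H k\<bar> \<le> inverse (real (Suc j))} \<in> sets P" for H j
    using fin(1)
    by (intro sets.sets_Collect_finite_All borel_measurable_le borel_measurable_const
         borel_measurable_abs borel_measurable_sum borel_measurable_times meas) auto
  then have "{A \<in> space P. \<exists>n. \<forall>j. \<exists>H \<in> D n j. \<forall>m\<in>R. \<bar>\<Sum>k\<in>G. A (m, k) * H k\<bar> \<le> inverse (real (Suc j))} \<in> sets P"
    by (intro sets.sets_Collect_countable_Ex sets.sets_Collect_countable_All sets.sets_Collect_countable_Ex' cD)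
  then show ?thesis unfolding iff .

qed

section \<open>Multiscale decomposition into boxes\<close>

definition grid_box :: "nat \<Rightarrow> multi_index \<Rightarrow> multi_index \<Rightarrow> multi_index set" where
  "grid_box d a b = (\<Pi>\<^sub>E i\<in>{1..d}. {a i..b i})"

text \<open>The corners are not ordered, so the empty set may occur among the boxes.\<close>

definition boxes :: "nat \<Rightarrow> nat \<Rightarrow> multi_index set set" where
  "boxes d N = (\<lambda>(a, b). grid_box d a b) ` (grid d N \<times> grid d N)"

definition mean :: "'k set \<Rightarrow> ('k \<Rightarrow> real) \<Rightarrow> real" where
  "mean Q H = (\<Sum>k\<in>Q. H k) / real (card Q)"

text \<open>Only edges with both ends in \<open>Q\<close> count, so disjoint parts of
  \<open>Q\<close> share no edge.\<close>

definition local_tv :: "nat \<Rightarrow> multi_index set \<Rightarrow> (multi_index \<Rightarrow> real) \<Rightarrow> real" where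
  "local_tv d Q H = (\<Sum>(i, k) \<in> {(i, k). i \<in> {1..d} \<and> k \<in> Q \<and> k(i := k i + 1) \<in> Q}.
     \<bar>H (k(i := k i + 1)) - H k\<bar>)"

text \<open>The gauge of the absolutely convex hull of the \<open>\<ell>\<^sup>2\<close>-normalised indicators of boxes.\<close>

definition box_norm_le :: "nat \<Rightarrow> nat \<Rightarrow> (multi_index \<Rightarrow> real) \<Rightarrow> real \<Rightarrow> bool" where
  "box_norm_le d N f r \<longleftrightarrow> (\<exists>c. (\<forall>k\<in>grid d N. f k = (\<Sum>P\<in>boxes d N. c P * indicator P k)) \<and>
     (\<Sum>P\<in>boxes d N. \<bar>c P\<bar> * sqrt (card P)) \<le> r)"

section \<open>Boxes and the variation inside them\<close>

lemma finite_grid [simp]: "finite (grid d N)"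
  by (simp add: grid_def finite_PiE)

lemma card_grid: "card (grid d N) = N ^ d"
  by (simp add: grid_def card_PiE)

lemma finite_grid_box [simp]: "finite (grid_box d a b)"
  by (simp add: grid_box_def finite_PiE)

lemma finite_boxes [simp]: "finite (boxes d N)"
  by (simp add: boxes_def)

lemma card_boxes_le: "card (boxes d N) \<le> N ^ (2 * d)"
proof -
  have "card (boxes d N) \<le> card (grid d N \<times> grid d N)"
    unfolding boxes_def by (rule card_image_le) simp
  then show ?thesis by (simp add: card_cartesian_product card_grid power_add mult_2)
qed

lemma grid_box_in_boxes: "a \<in> grid d N \<Longrightarrow> b \<in> grid d N \<Longrightarrow> grid_box d a b \<in> boxes d N"
  by (auto simp: boxes_def)

lemma grid_box_subset_grid:
  assumes "a \<in> grid d N" "b \<in> grid d N"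
  shows "grid_box d a b \<subseteq> grid d N"
  using assms unfolding grid_box_def grid_def PiE_def Pi_def
  by (auto intro: order_trans)

lemma finite_boxes_elem: "P \<in> boxes d N \<Longrightarrow> finite P"
  by (auto simp: boxes_def)

lemma card_grid_box: "card (grid_box d a b) = (\<Prod>i\<in>{1..d}. Suc (b i) - a i)"
  by (simp add: grid_box_def card_PiE)

lemma local_tv_nonneg: "local_tv d Q H \<ge> 0"
  unfolding local_tv_def by (intro sum_nonneg) auto

lemma finite_local_tv_index: "finite Q \<Longrightarrow> finite {(i, k). i \<in> {1..d::nat} \<and> k \<in> Q \<and> k(i := k i + 1::nat) \<in> Q}"
  by (rule finite_subset[of _ "{1..d} \<times> Q"]) auto

text \<open>Edges inside \<open>L\<close> and inside \<open>R\<close> are disjoint families of edges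
  inside \<open>Q\<close>; edges across the cut are discarded. This keeps the cost of a whole
  generation of boxes below the variation on the grid.\<close>

lemma local_tv_disjoint_le:
  assumes "finite Q" "L \<subseteq> Q" "R \<subseteq> Q" "L \<inter> R = {}"
  shows "local_tv d L H + local_tv d R H \<le> local_tv d Q H"
proof -
  let ?I = "\<lambda>Q. {(i, k). i \<in> {1..d} \<and> k \<in> Q \<and> k(i := k i + 1) \<in> Q}"
  let ?f = "\<lambda>(i, k). \<bar>H (k(i := k i + 1)) - H k\<bar>"
  have "finite (?I L)" "finite (?I R)"
    by (intro finite_local_tv_index finite_subset[OF assms(2,1)] finite_subset[OF assms(3,1)])+
  then have "sum ?f (?I L) + sum ?f (?I R) = sum ?f (?I L \<union> ?I R)"
    using assms(4) by (intro sum.union_disjoint[symmetric]) auto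
  also have "\<dots> \<le> sum ?f (?I Q)"
    using assms by (intro sum_mono2 finite_local_tv_index) auto
  finally show ?thesis unfolding local_tv_def .
qed

lemma total_variation_eq_local_tv:
  assumes "N \<ge> 1"
  shows "total_variation d N H = local_tv d (grid d N) H"
proof -
  have "k i \<le> N - 1 \<longleftrightarrow> k(i := k i + 1) \<in> grid d N" if "i \<in> {1..d}" "k \<in> grid d N" for i k
  proof -
    have "k(i := k i + 1) \<in> grid d N \<longleftrightarrow> k i + 1 \<le> N"
      using that by (force simp: grid_def PiE_iff extensional_def)
    then show ?thesis using assms by auto
  qed
  then have eq: "grad_index d N = {(i, k). i \<in> {1..d} \<and> k \<in> grid d N \<and> k(i := k i + 1) \<in> grid d N}"
    unfolding grad_index_def by blast
  show ?thesis
    unfolding total_variation_def local_tv_def eq[symmetric]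
    by (intro sum.cong refl) (auto simp: discrete_gradient_def)
qed

section \<open>The box norm as a gauge\<close>

lemma box_norm_le_add:
  assumes "box_norm_le d N f r" "box_norm_le d N g s"
  shows "box_norm_le d N (\<lambda>k. f k + g k) (r + s)"
proof -
  obtain c e where c: "\<And>k. k \<in> grid d N \<Longrightarrow> f k = (\<Sum>P\<in>boxes d N. c P * indicator P k)"
      "(\<Sum>P\<in>boxes d N. \<bar>c P\<bar> * sqrt (card P)) \<le> r"
    and e: "\<And>k. k \<in> grid d N \<Longrightarrow> g k = (\<Sum>P\<in>boxes d N. e P * indicator P k)"
      "(\<Sum>P\<in>boxes d N. \<bar>e P\<bar> * sqrt (card P)) \<le> s"
    using assms unfolding box_norm_le_def by blast
  have "(\<Sum>P\<in>boxes d N. \<bar>c P + e P\<bar> * sqrt (card P))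
      \<le> (\<Sum>P\<in>boxes d N. \<bar>c P\<bar> * sqrt (card P) + \<bar>e P\<bar> * sqrt (card P))"
    unfolding distrib_right[symmetric] by (intro sum_mono mult_right_mono abs_triangle_ineq) auto
  also have "\<dots> \<le> r + s"
    using c(2) e(2) by (simp add: sum.distrib)
  finally show ?thesis unfolding box_norm_le_def
    by (intro exI[of _ "\<lambda>P. c P + e P"]) (simp add: c(1) e(1) distrib_right sum.distrib)
qed

lemma box_norm_le_indicator:
  assumes "P \<in> boxes d N"
  shows "box_norm_le d N (\<lambda>k. x * indicator P k) (\<bar>x\<bar> * sqrt (card P))"
  unfolding box_norm_le_def
proof (intro exI conjI ballI)
  let ?c = "\<lambda>P'. if P' = P then x else 0"
  show "x * indicator P k = (\<Sum>P'\<in>boxes d N. ?c P' * indicator P' k)" for k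
    using assms by (simp add: if_distrib[of "\<lambda>x. x * _"] sum.delta cong: if_cong)
  have "(\<Sum>P'\<in>boxes d N. \<bar>?c P'\<bar> * sqrt (card P')) = (\<Sum>P'\<in>boxes d N. if P' = P then \<bar>x\<bar> * sqrt (card P) else 0)"
    by (intro sum.cong) auto
  also have "\<dots> = \<bar>x\<bar> * sqrt (card P)" using assms by simp
  finally show "(\<Sum>P'\<in>boxes d N. \<bar>?c P'\<bar> * sqrt (card P')) \<le> \<bar>x\<bar> * sqrt (card P)" by simp
qed

lemma box_norm_le_mono:
  assumes "box_norm_le d N f r" "r \<le> s" "\<And>k. k \<in> grid d N \<Longrightarrow> g k = f k"
  shows "box_norm_le d N g s"
proof -
  obtain c where "\<forall>k\<in>grid d N. f k = (\<Sum>P\<in>boxes d N. c P * indicator P k)"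
      "(\<Sum>P\<in>boxes d N. \<bar>c P\<bar> * sqrt (card P)) \<le> r"
    using assms(1) unfolding box_norm_le_def by blast
  then show ?thesis
    unfolding box_norm_le_def using assms(2,3) by (intro exI[of _ c]) auto
qed

lemma box_norm_le_zero: "r \<ge> 0 \<Longrightarrow> box_norm_le d N (\<lambda>k. 0) r"
  unfolding box_norm_le_def by (intro exI[of _ "\<lambda>_. 0"]) auto

section \<open>Comparing the mean over a slab with the mean over its box\<close>

lemma abs_diff_le_variation:
  fixes h :: "nat \<Rightarrow> real"
  assumes "x \<in> {a..b}" "y \<in> {a..b}"
  shows "\<bar>h x - h y\<bar> \<le> (\<Sum>j=a..<b. \<bar>h (j + 1) - h j\<bar>)"
  using assms
proof (induction x y rule: linorder_wlog)
  case (le x y)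
  have "\<bar>h y - h x\<bar> = \<bar>\<Sum>j=x..<y. h (Suc j) - h j\<bar>"
    using le by (subst sum_Suc_diff') auto
  also have "\<dots> \<le> (\<Sum>j=x..<y. \<bar>h (Suc j) - h j\<bar>)" by (rule sum_abs)
  also have "\<dots> \<le> (\<Sum>j=a..<b. \<bar>h (Suc j) - h j\<bar>)"
    using le by (intro sum_mono2) auto
  finally show ?case by (simp add: abs_minus_commute)
next
  case (sym x y)
  then show ?case by (simp add: abs_minus_commute)
qed

text \<open>The difference of the means is the average of \<open>h x - h y\<close> over all pairs in
  \<open>A \<times> B\<close>; the two sets may overlap.\<close>

lemma mean_diff_le:
  assumes "finite A" "A \<noteq> {}" "finite B" "B \<noteq> {}"
    and "\<And>x y. x \<in> A \<Longrightarrow> y \<in> B \<Longrightarrow> \<bar>h x - h y\<bar> \<le> V"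
  shows "\<bar>mean A h - mean B h\<bar> \<le> V"
proof -
  have pos: "real (card A) > 0" "real (card B) > 0" using assms by (auto simp: card_gt_0_iff)
  have "(\<Sum>x\<in>A. \<Sum>y\<in>B. h x - h y) = real (card B) * (\<Sum>x\<in>A. h x) - real (card A) * (\<Sum>y\<in>B. h y)"
    by (simp add: sum_subtractf sum_distrib_left)
  then have "mean A h - mean B h = (\<Sum>x\<in>A. \<Sum>y\<in>B. h x - h y) / (real (card A) * real (card B))"
    using pos by (simp add: mean_def field_simps)
  moreover have "\<bar>\<Sum>x\<in>A. \<Sum>y\<in>B. h x - h y\<bar> \<le> (\<Sum>x\<in>A. \<Sum>y\<in>B. V)"
    by (intro order_trans[OF sum_abs] sum_mono assms(5)) 
  ultimately show ?thesis
    using pos by (simp add: abs_mult divide_le_eq mult.commute mult.left_commute)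
qed

lemma sum_PiE_split:
  assumes "i \<in> J"
  shows "(\<Sum>k\<in>PiE J T. f k) = (\<Sum>g\<in>PiE (J - {i}) T. \<Sum>x\<in>T i. f (g(i := x)))"
proof -
  have "PiE J T = (\<lambda>(x, g). g(i := x)) ` (T i \<times> PiE (J - {i}) T)"
    using PiE_insert_eq[of i "J - {i}" T] assms by (simp add: insert_absorb)
  then have "(\<Sum>k\<in>PiE J T. f k) = (\<Sum>(x, g)\<in>T i \<times> PiE (J - {i}) T. f (g(i := x)))"
    using inj_combinator[of i "J - {i}" T]
    by (simp add: sum.reindex case_prod_unfold comp_def)
  also have "\<dots> = (\<Sum>x\<in>T i. \<Sum>g\<in>PiE (J - {i}) T. f (g(i := x)))"
    by (simp add: sum.cartesian_product)
  finally show ?thesis by (simp add: sum.swap[of _ "T i"])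
qed

lemma mean_PiE_split:
  assumes "i \<in> J" "finite J"
  shows "mean (PiE J T) H * real (card (PiE (J - {i}) T))
    = (\<Sum>g\<in>PiE (J - {i}) T. mean (T i) (\<lambda>x. H (g(i := x))))"
proof (cases "card (PiE (J - {i}) T) = 0")
  case False
  have "card (PiE J T) = card (T i) * card (PiE (J - {i}) T)"
    using assms by (simp add: card_PiE prod.remove)
  then show ?thesis
    using False assms(1) by (simp add: mean_def sum_PiE_split[of i] sum_divide_distrib[symmetric])
next
  \<comment> \<open>Both sides are 0: an empty or infinite set has cardinality 0 and sum 0.\<close>
  case True
  then have "PiE (J - {i}) T = {} \<or> infinite (PiE (J - {i}) T)" by (simp add: card_eq_0_iff)
  then show ?thesis using True by auto
qed

text \<open>On each line in direction \<open>i\<close> the mean over \<open>I\<close> and the mean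
  over the full side differ by at most the variation along that line. Distinct lines have distinct
  edges, so summing over the cross section stays below the variation in the box.\<close>

lemma mean_slab_diff_le:
  assumes i: "i \<in> {1..d}" and I: "I \<noteq> {}" "I \<subseteq> {a i..b i}"
  shows "\<bar>mean (PiE {1..d} ((\<lambda>j. {a j..b j})(i := I))) H - mean (grid_box d a b) H\<bar>
      * real (card (PiE ({1..d} - {i}) (\<lambda>j. {a j..b j}))) \<le> local_tv d (grid_box d a b) H"
proof -
  let ?S = "\<lambda>j. {a j..b j}"
  let ?R = "PiE ({1..d} - {i}) ?S"
  have R: "PiE ({1..d} - {i}) (?S(i := I)) = ?R" by (rule PiE_cong) auto
  have finR: "finite ?R" by (simp add: finite_PiE)
  let ?V = "\<lambda>g. \<Sum>j=a i..<b i. \<bar>H (g(i := j + 1)) - H (g(i := j))\<bar>"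
  have e1: "mean (PiE {1..d} (?S(i := I))) H * real (card ?R) = (\<Sum>g\<in>?R. mean I (\<lambda>x. H (g(i := x))))"
    using mean_PiE_split[OF i, of "?S(i := I)" H] unfolding R by simp
  have e2: "mean (grid_box d a b) H * real (card ?R) = (\<Sum>g\<in>?R. mean (?S i) (\<lambda>x. H (g(i := x))))"
    using mean_PiE_split[OF i, of ?S H] unfolding grid_box_def by simp
  have "\<bar>mean (PiE {1..d} (?S(i := I))) H - mean (grid_box d a b) H\<bar> * real (card ?R)
     = \<bar>mean (PiE {1..d} (?S(i := I))) H * real (card ?R) - mean (grid_box d a b) H * real (card ?R)\<bar>"
    unfolding left_diff_distrib[symmetric] abs_mult by simp
  also have "\<dots> = \<bar>\<Sum>g\<in>?R. mean I (\<lambda>x. H (g(i := x))) - mean (?S i) (\<lambda>x. H (g(i := x)))\<bar>"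
    unfolding e1 e2 sum_subtractf ..
  also have "\<dots> \<le> (\<Sum>g\<in>?R. \<bar>mean I (\<lambda>x. H (g(i := x))) - mean (?S i) (\<lambda>x. H (g(i := x)))\<bar>)"
    by (rule sum_abs)
  also have "\<dots> \<le> (\<Sum>g\<in>?R. ?V g)"
  proof (intro sum_mono mean_diff_le)
    fix g x y assume "x \<in> I" "y \<in> {a i..b i}"
    then show "\<bar>H (g(i := x)) - H (g(i := y))\<bar> \<le> ?V g"
      using abs_diff_le_variation[of x "a i" "b i" y "\<lambda>x. H (g(i := x))"] I(2) by auto
  qed (use I in \<open>auto dest: finite_subset\<close>)
  also have "\<dots> = (\<Sum>(g, j)\<in>?R \<times> {a i..<b i}. \<bar>H (g(i := j + 1)) - H (g(i := j))\<bar>)"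
    by (rule sum.cartesian_product)
  also have "\<dots> = (\<Sum>(l, k)\<in>(\<lambda>(g, j). (i, g(i := j))) ` (?R \<times> {a i..<b i}). \<bar>H (k(l := k l + 1)) - H k\<bar>)"
  proof (subst sum.reindex)
    \<comment> \<open>The edge determines the line: \<open>g\<close> is extensional off
      \<open>i\<close>, hence \<open>undefined\<close> there, and is recovered by resetting that
      coordinate.\<close>
    show "inj_on (\<lambda>(g, j). (i, g(i := j))) (?R \<times> {a i..<b i})"
    proof (rule inj_onI)
      fix p q assume "p \<in> ?R \<times> {a i..<b i}" "q \<in> ?R \<times> {a i..<b i}"
        and eq: "(case p of (g, j) \<Rightarrow> (i, g(i := j))) = (case q of (g, j) \<Rightarrow> (i, g(i := j)))"
      moreover obtain g j g' j' where pq: "p = (g, j)" "q = (g', j')" by (cases p, cases q)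
      ultimately have "g i = undefined" "g' i = undefined" and eq': "g(i := j) = g'(i := j')"
        by (auto simp: PiE_def extensional_def)
      then have "g = g'" by (metis fun_upd_triv fun_upd_upd)
      moreover have "j = j'" using fun_cong[OF eq', of i] by simp
      ultimately show "p = q" by (simp add: pq)
    qed
  qed (simp add: case_prod_unfold)
  also have "\<dots> \<le> local_tv d (grid_box d a b) H"
    unfolding local_tv_def
  proof (rule sum_mono2)
    have "g(i := j) \<in> grid_box d a b" if "g \<in> ?R" "j \<in> {a i..b i}" for g j
      using that i by (simp add: grid_box_def PiE_iff extensional_def) blast
    then show "(\<lambda>(g, j). (i, g(i := j))) ` (?R \<times> {a i..<b i})
        \<subseteq> {(i, k). i \<in> {1..d} \<and> k \<in> grid_box d a b \<and> k(i := k i + 1) \<in> grid_box d a b}"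
      using i by fastforce
    show "finite {(i, k). i \<in> {1..d} \<and> k \<in> grid_box d a b \<and> k(i := k i + 1) \<in> grid_box d a b}"
      by (rule finite_local_tv_index) simp
  qed auto
  finally show ?thesis .
qed

text \<open>The longest side is halved. This keeps the ratio of the side lengths at most 3, and both
  halves have at most 2/3 of the points (the extreme case is a side of length 3).\<close>

lemma grid_box_decomposition:
  fixes \<phi> :: "nat \<Rightarrow> real"
  assumes \<phi>: "\<And>m n. 1 \<le> m \<Longrightarrow> 3 * m \<le> 2 * n \<Longrightarrow> \<phi> m + 6 * real n powr (1 / real d - 1 / 2) \<le> \<phi> n"
    and \<phi>0: "\<And>n. n \<ge> 1 \<Longrightarrow> \<phi> n \<ge> 0" and "d \<ge> 1"
  assumes "a \<in> grid d N" "b \<in> grid d N" and ab: "\<And>i. i \<in> {1..d} \<Longrightarrow> a i \<le> b i"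
    and ratio: "\<And>i j. i \<in> {1..d} \<Longrightarrow> j \<in> {1..d} \<Longrightarrow> Suc (b i) - a i \<le> 3 * (Suc (b j) - a j)"
  shows "box_norm_le d N (\<lambda>k. (H k - mean (grid_box d a b) H) * indicator (grid_box d a b) k)
    (\<phi> (card (grid_box d a b)) * local_tv d (grid_box d a b) H)"
  using assms(4-)
proof (induction "card (grid_box d a b)" arbitrary: a b rule: less_induct)
  case less
  note a = less.prems(1) and b = less.prems(2) and ab = less.prems(3) and ratio = less.prems(4)
  define s where "s i = Suc (b i) - a i" for i
  have s1: "s i \<ge> 1" if "i \<in> {1..d}" for i using ab[OF that] by (simp add: s_def)
  let ?Q = "grid_box d a b"
  have cardQ: "card ?Q = (\<Prod>i\<in>{1..d}. s i)" by (simp add: card_grid_box s_def)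
  then have Q1: "card ?Q \<ge> 1" using prod_ge_1[of "{1..d}" s] s1 by simp
  show ?case
  proof (cases "\<forall>i\<in>{1..d}. s i = 1")
    \<comment> \<open>All sides have length 1: the box is a single point and the deviation from its
      mean vanishes.\<close>
    case True
    then have eq: "b i = a i" if "i \<in> {1..d}" for i
      using ab[OF that] that by (force simp: s_def)
    have "?Q = PiE {1..d} (\<lambda>i. {a i})"
      unfolding grid_box_def by (rule PiE_cong) (simp add: eq)
    also have "\<dots> = {a}"
      using a by (intro PiE_singleton) (simp add: grid_def PiE_def)
    finally have Q: "?Q = {a}" .
    have "(\<lambda>k. (H k - mean {a} H) * indicator {a} k) = (\<lambda>k. 0)"
      by (auto simp: mean_def indicator_def)
    moreover have "box_norm_le d N (\<lambda>k. 0) (\<phi> (card {a}) * local_tv d {a} H)"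
      by (intro box_norm_le_zero mult_nonneg_nonneg \<phi>0 local_tv_nonneg) simp
    ultimately show ?thesis unfolding Q by (simp only:)
  next
    case False
    obtain i where i: "i \<in> {1..d}" and max: "\<And>j. j \<in> {1..d} \<Longrightarrow> s j \<le> s i"
    proof -
      have "Max (s ` {1..d}) \<in> s ` {1..d}" using assms(3) by (intro Max_in) auto
      then obtain i where "i \<in> {1..d}" "s i = Max (s ` {1..d})" by auto
      then show ?thesis by (intro that[of i]) auto
    qed
    from False obtain j where "j \<in> {1..d}" "s j \<noteq> 1" by blast
    then have si: "s i \<ge> 2" using s1[of j] max[of j] by linarith
    define h where "h = s i div 2"
    define m where "m = a i + h - 1"
    \<comment> \<open>The third and sixth bounds keep both new sides at least a third of the longest
      side, as the ratio condition requires; the fourth and fifth give the factor 2/3 for the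
      cardinalities.\<close>
    have h: "1 \<le> h" "h < s i" "s i \<le> 3 * h" "3 * h \<le> 2 * s i"
        "3 * (s i - h) \<le> 2 * s i" "s i \<le> 3 * (s i - h)"
      using si by (auto simp: h_def)
    have m: "a i \<le> m" "m < b i" "Suc m - a i = h" "Suc (b i) - Suc m = s i - h"
      using h by (auto simp: m_def s_def)
    define b' where "b' = b(i := m)"
    define a' where "a' = a(i := Suc m)"
    let ?L = "grid_box d a b'"
    let ?R = "grid_box d a' b"
    let ?S = "\<lambda>j. {a j..b j}"
    let ?C = "PiE ({1..d} - {i}) ?S"
    have bnd: "1 \<le> a i" "b i \<le> N"
      using a b i by (auto simp: grid_def)
    have b': "b' \<in> grid d N" and a': "a' \<in> grid d N"
      using a b i m bnd unfolding a'_def b'_def grid_def PiE_def extensional_def by auto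
    have L: "?L = PiE {1..d} (?S(i := {a i..m}))"
      unfolding grid_box_def by (rule PiE_cong) (simp add: b'_def)
    have R: "?R = PiE {1..d} (?S(i := {Suc m..b i}))"
      unfolding grid_box_def by (rule PiE_cong) (simp add: a'_def)
    have S_split: "?S i = {a i..m} \<union> {Suc m..b i}" using m by auto
    have PX: "PiE {1..d} (?S(i := X)) = {k \<in> ?Q. k i \<in> X}" if X: "X \<subseteq> ?S i" for X
    proof (intro set_eqI iffI)
      fix k assume k: "k \<in> PiE {1..d} (?S(i := X))"
      have "k j \<in> ?S j" if "j \<in> {1..d}" for j
        using PiE_mem[OF k that] X by (cases "j = i") auto
      moreover have "k i \<in> X" using PiE_mem[OF k i] by simp
      moreover have "k \<in> extensional {1..d}" using k by (simp add: PiE_def)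
      ultimately show "k \<in> {k \<in> ?Q. k i \<in> X}" unfolding grid_box_def PiE_iff by blast
    next
      fix k assume k: "k \<in> {k \<in> ?Q. k i \<in> X}"
      then have "k j \<in> (?S(i := X)) j" if "j \<in> {1..d}" for j
        using that PiE_mem[of k "{1..d}" ?S j] by (cases "j = i") (simp_all add: grid_box_def)
      then show "k \<in> PiE {1..d} (?S(i := X))" using k unfolding grid_box_def PiE_iff by blast
    qed
    have mem: "k i \<in> {a i..m} \<union> {Suc m..b i}" if "k \<in> ?Q" for k
      using that i S_split unfolding grid_box_def PiE_iff by blast
    have L': "?L = {k \<in> ?Q. k i \<in> {a i..m}}" and R': "?R = {k \<in> ?Q. k i \<in> {Suc m..b i}}"
      unfolding L R using S_split by (intro PX; blast)+
    have un: "?Q = ?L \<union> ?R" unfolding L' R' using mem by blast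
    have sub: "?L \<subseteq> ?Q" "?R \<subseteq> ?Q" using un by blast+
    have disj: "?L \<inter> ?R = {}" unfolding L' R' by auto
    have cQ: "card ?Q = s i * card ?C"
      using i by (simp add: grid_box_def card_PiE s_def prod.remove[of _ i])
    have C_eq: "PiE ({1..d} - {i}) (?S(i := X)) = ?C" for X by (rule PiE_cong) auto
    have cX: "card (PiE {1..d} (?S(i := X))) = card X * card ?C" for X
      using i C_eq[of X] by (simp add: card_PiE prod.remove[of _ i])
    have cL: "card ?L = h * card ?C" and cR: "card ?R = (s i - h) * card ?C"
      unfolding L R cX using m by auto
    have C1: "card ?C \<ge> 1" using Q1 cQ by (cases "card ?C") auto
    have sL: "Suc (b' j) - a j = (if j = i then h else s j)" for j
      using m by (auto simp: b'_def s_def)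
    have sR: "Suc (b j) - a' j = (if j = i then s i - h else s j)" for j
      using m by (auto simp: a'_def s_def)
    have rat: "s i \<le> 3 * s j" if "j \<in> {1..d}" for j
      using ratio[OF i that] by (simp add: s_def)
    have IL: "box_norm_le d N (\<lambda>k. (H k - mean ?L H) * indicator ?L k) (\<phi> (card ?L) * local_tv d ?L H)"
    proof (rule less.hyps[OF _ a b'])
      show "card ?L < card ?Q" using cL cQ C1 h by simp
      show "a j \<le> b' j" if "j \<in> {1..d}" for j using ab[OF that] m by (simp add: b'_def)
      show "Suc (b' j) - a j \<le> 3 * (Suc (b' k) - a k)" if "j \<in> {1..d}" "k \<in> {1..d}" for j k
        unfolding sL using h max[OF that(1)] rat[OF that(2)] by auto
    qed
    have IR: "box_norm_le d N (\<lambda>k. (H k - mean ?R H) * indicator ?R k) (\<phi> (card ?R) * local_tv d ?R H)"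
    proof (rule less.hyps[OF _ a' b])
      show "card ?R < card ?Q" using cR cQ C1 h by simp
      show "a' j \<le> b j" if "j \<in> {1..d}" for j using ab[OF that] m by (simp add: a'_def)
      show "Suc (b j) - a' j \<le> 3 * (Suc (b k) - a' k)" if "j \<in> {1..d}" "k \<in> {1..d}" for j k
        unfolding sR using h max[OF that(1)] rat[OF that(2)] by auto
    qed
    \<comment> \<open>Replacing the mean of \<open>?Q\<close> by the means of the halves creates two
      new atoms with these coefficients.\<close>
    define xL where "xL = mean ?L H - mean ?Q H"
    define xR where "xR = mean ?R H - mean ?Q H"
    have JL: "box_norm_le d N (\<lambda>k. xL * indicator ?L k) (\<bar>xL\<bar> * sqrt (card ?L))"
      and JR: "box_norm_le d N (\<lambda>k. xR * indicator ?R k) (\<bar>xR\<bar> * sqrt (card ?R))"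
      by (intro box_norm_le_indicator grid_box_in_boxes a b a' b')+
    let ?q = "real (card ?Q) powr (1 / real d - 1 / 2)"
    let ?V = "local_tv d ?Q H"
    have V0: "?V \<ge> 0" by (rule local_tv_nonneg)
    have C0: "real (card ?C) > 0" using C1 by linarith
    have dL: "\<bar>xL\<bar> \<le> ?V / real (card ?C)"
      using mean_slab_diff_le[OF i, of "{a i..m}" a b H] m C0 unfolding xL_def L
      by (simp add: pos_le_divide_eq)
    have dR: "\<bar>xR\<bar> \<le> ?V / real (card ?C)"
      using mean_slab_diff_le[OF i, of "{Suc m..b i}" a b H] m C0 unfolding xR_def R
      by (simp add: pos_le_divide_eq)
    \<comment> \<open>The quotient equals \<open>s i / sqrt (card ?Q)\<close>, and since every side
      is at least \<open>s i / 3\<close>, \<open>s i\<close> is at most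
      \<open>3 * card ?Q powr (1 / d)\<close>.\<close>
    have side: "sqrt (card ?Q) / real (card ?C) \<le> 3 * ?q"
    proof -
      have "(real (s i) / 3) ^ d = (\<Prod>j\<in>{1..d}. real (s i) / 3)" by simp
      also have "\<dots> \<le> (\<Prod>j\<in>{1..d}. real (s j))"
      proof (intro prod_mono conjI)
        fix j assume "j \<in> {1..d}"
        from of_nat_mono[OF rat[OF this], where ?'a = real] show "real (s i) / 3 \<le> real (s j)" by simp
      qed simp
      also have "\<dots> = real (card ?Q)" by (simp add: cardQ)
      finally have "(real (s i) / 3) powr real d \<le> real (card ?Q)"
        using si by (simp add: powr_realpow)
      then have "((real (s i) / 3) powr real d) powr (1 / real d) \<le> real (card ?Q) powr (1 / real d)"
        by (intro powr_mono2) auto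
      then have "real (s i) / 3 \<le> real (card ?Q) powr (1 / real d)"
        using si assms(3) by (simp add: powr_powr)
      moreover have "sqrt (card ?Q) / real (card ?C) = real (s i) / sqrt (card ?Q)"
      proof -
        have "real (card ?Q) = real (s i) * real (card ?C)" unfolding cQ by (rule of_nat_mult)
        then have "sqrt (card ?Q) * sqrt (card ?Q) = real (s i) * real (card ?C)"
          by (metis of_nat_0_le_iff real_sqrt_mult_self abs_of_nonneg)
        moreover have "sqrt (card ?Q) \<noteq> 0" using Q1 unfolding real_sqrt_eq_0_iff of_nat_eq_0_iff by linarith
        ultimately show ?thesis using frac_eq_eq[of "real (card ?C)"] C0 by force
      qed
      moreover have "3 * ?q = 3 * real (card ?Q) powr (1 / real d) / sqrt (card ?Q)"
        by (simp add: powr_diff powr_half_sqrt)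
      ultimately show ?thesis
        by (simp add: divide_right_mono)
    qed
    have term_le: "\<bar>x\<bar> * sqrt (real n) \<le> 3 * ?q * ?V" if "\<bar>x\<bar> \<le> ?V / real (card ?C)" "n \<le> card ?Q" for x n
    proof -
      have "\<bar>x\<bar> * sqrt (real n) \<le> ?V / real (card ?C) * sqrt (card ?Q)"
        using that V0 by (intro mult_mono) auto
      also have "\<dots> = sqrt (card ?Q) / real (card ?C) * ?V" by simp
      also have "\<dots> \<le> 3 * ?q * ?V" by (intro mult_right_mono side V0)
      finally show ?thesis .
    qed
    \<comment> \<open>The two halves together cost \<open>6 * ?q * ?V\<close>, which is the
      increment that \<open>\<phi>\<close> has to provide per generation.\<close>
    have tL: "\<bar>xL\<bar> * sqrt (card ?L) \<le> 3 * ?q * ?V" and tR: "\<bar>xR\<bar> * sqrt (card ?R) \<le> 3 * ?q * ?V"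
      by (intro term_le dL dR card_mono finite_grid_box sub)+
    have pL: "\<phi> (card ?L) \<le> \<phi> (card ?Q) - 6 * ?q" and pR: "\<phi> (card ?R) \<le> \<phi> (card ?Q) - 6 * ?q"
    proof -
      have "1 \<le> card ?L" "3 * card ?L \<le> 2 * card ?Q" "1 \<le> card ?R" "3 * card ?R \<le> 2 * card ?Q"
        using mult_le_mono[OF h(1) C1] mult_le_mono1[OF h(4), of "card ?C"]
          mult_le_mono[OF _ C1, of 1 "s i - h"] mult_le_mono1[OF h(5), of "card ?C"] h(2)
        unfolding cL cR cQ by (simp_all only: mult.assoc mult_1)
      then show "\<phi> (card ?L) \<le> \<phi> (card ?Q) - 6 * ?q" "\<phi> (card ?R) \<le> \<phi> (card ?Q) - 6 * ?q"
        using \<phi>[of "card ?L" "card ?Q"] \<phi>[of "card ?R" "card ?Q"] by linarith+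
    qed
    have "0 \<le> \<phi> (card ?L)"
      using mult_le_mono[OF h(1) C1] unfolding cL by (intro \<phi>0) simp
    \<comment> \<open>A nonnegative common factor is needed to apply the superadditivity of
      \<open>local_tv\<close>.\<close>
    then have pos: "0 \<le> \<phi> (card ?Q) - 6 * ?q" using pL by linarith
    have "\<phi> (card ?L) * local_tv d ?L H + \<phi> (card ?R) * local_tv d ?R H
        \<le> (\<phi> (card ?Q) - 6 * ?q) * local_tv d ?L H + (\<phi> (card ?Q) - 6 * ?q) * local_tv d ?R H"
      by (intro add_mono mult_right_mono pL pR local_tv_nonneg)
    also have "\<dots> = (\<phi> (card ?Q) - 6 * ?q) * (local_tv d ?L H + local_tv d ?R H)"
      by (simp add: distrib_left)
    also have "\<dots> \<le> (\<phi> (card ?Q) - 6 * ?q) * ?V"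
      by (intro mult_left_mono pos local_tv_disjoint_le disj sub finite_grid_box)
    finally have total: "(\<phi> (card ?L) * local_tv d ?L H + \<phi> (card ?R) * local_tv d ?R H)
        + (\<bar>xL\<bar> * sqrt (card ?L) + \<bar>xR\<bar> * sqrt (card ?R)) \<le> \<phi> (card ?Q) * ?V"
      using tL tR by (simp add: left_diff_distrib)
    have eq: "(H k - mean ?Q H) * indicator ?Q k =
        ((H k - mean ?L H) * indicator ?L k + (H k - mean ?R H) * indicator ?R k)
        + (xL * indicator ?L k + xR * indicator ?R k)" for k
    proof -
      have "k \<in> ?Q \<longleftrightarrow> k \<in> ?L \<or> k \<in> ?R" "\<not> (k \<in> ?L \<and> k \<in> ?R)" using un disj by blast+
      then show ?thesis by (cases "k \<in> ?L"; cases "k \<in> ?R") (simp_all add: xL_def xR_def)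
    qed
    show ?thesis
      by (rule box_norm_le_mono[OF box_norm_le_add[OF box_norm_le_add[OF IL IR] box_norm_le_add[OF JL JR]] total])
        (rule eq)
  qed
qed

text \<open>The full grid is a cube, so the decomposition applies to the deviation from the global
  mean. The constant part is one atom, whose coefficient Cauchy-Schwarz bounds by the Euclidean
  norm.\<close>

lemma box_norm_le_total_variation:
  fixes \<phi> :: "nat \<Rightarrow> real"
  assumes \<phi>: "\<And>m n. 1 \<le> m \<Longrightarrow> 3 * m \<le> 2 * n \<Longrightarrow> \<phi> m + 6 * real n powr (1 / real d - 1 / 2) \<le> \<phi> n"
    and \<phi>0: "\<And>n. n \<ge> 1 \<Longrightarrow> \<phi> n \<ge> 0" and d: "d \<ge> 1" and N: "N \<ge> 1"
  shows "box_norm_le d N H (sqrt (\<Sum>k\<in>grid d N. (H k)\<^sup>2) + \<phi> (N ^ d) * total_variation d N H)"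
proof -
  let ?G = "grid d N"
  define a where "a = (\<lambda>i\<in>{1..d}. 1::nat)"
  define b where "b = (\<lambda>i\<in>{1..d}. N)"
  have ab: "a \<in> ?G" "b \<in> ?G" using N by (auto simp: grid_def a_def b_def)
  have G: "grid_box d a b = ?G"
    unfolding grid_box_def grid_def by (rule PiE_cong) (simp add: a_def b_def)
  have 1: "box_norm_le d N (\<lambda>k. (H k - mean ?G H) * indicator ?G k) (\<phi> (N ^ d) * total_variation d N H)"
  proof -
    have "a i = 1" "b i = N" if "i \<in> {1..d}" for i using that by (auto simp: a_def b_def)
    then show ?thesis
      using grid_box_decomposition[OF \<phi> \<phi>0 d ab, of H] N
      unfolding G card_grid total_variation_eq_local_tv[OF N] by simp
  qed
  have 2: "box_norm_le d N (\<lambda>k. mean ?G H * indicator ?G k) (\<bar>mean ?G H\<bar> * sqrt (card ?G))"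
    using grid_box_in_boxes[OF ab] by (intro box_norm_le_indicator) (simp add: G)
  have "\<bar>mean ?G H\<bar> * sqrt (card ?G) \<le> sqrt (\<Sum>k\<in>?G. (H k)\<^sup>2)"
  proof -
    have c: "real (card ?G) > 0" using N by (simp add: card_grid)
    have "\<bar>\<Sum>k\<in>?G. H k\<bar> \<le> (\<Sum>k\<in>?G. \<bar>H k\<bar> * \<bar>1\<bar>)" by simp
    also have "\<dots> \<le> L2_set H ?G * L2_set (\<lambda>_. 1) ?G" by (rule L2_set_mult_ineq)
    also have "\<dots> = sqrt (\<Sum>k\<in>?G. (H k)\<^sup>2) * sqrt (card ?G)" by (simp add: L2_set_def)
    finally have "\<bar>\<Sum>k\<in>?G. H k\<bar> * sqrt (card ?G) \<le> sqrt (\<Sum>k\<in>?G. (H k)\<^sup>2) * sqrt (card ?G) * sqrt (card ?G)"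
      by (rule mult_right_mono) simp
    then have "\<bar>\<Sum>k\<in>?G. H k\<bar> * sqrt (card ?G) \<le> sqrt (\<Sum>k\<in>?G. (H k)\<^sup>2) * real (card ?G)"
      by (simp add: mult.assoc)
    then show ?thesis using c by (simp add: mean_def pos_divide_le_eq)
  qed
  then have le: "\<bar>mean ?G H\<bar> * sqrt (card ?G) + \<phi> (N ^ d) * total_variation d N H
      \<le> sqrt (\<Sum>k\<in>?G. (H k)\<^sup>2) + \<phi> (N ^ d) * total_variation d N H" by simp
  show ?thesis
    by (rule box_norm_le_mono[OF box_norm_le_add[OF 2 1] le]) simp
qed

text \<open>In the first case the weight is a multiple of \<open>ln n\<close>, in the second a multiple of
  \<open>1 - n powr (1 / d - 1 / 2)\<close>, where the exponent is negative.\<close>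

lemma splitting_weight_exists:
  assumes d: "d \<ge> 2"
  shows "\<exists>\<phi> c. c > 0 \<and> (\<forall>m n. 1 \<le> m \<longrightarrow> 3 * m \<le> 2 * n \<longrightarrow>
        \<phi> m + 6 * real n powr (1 / real d - 1 / 2) \<le> \<phi> n) \<and> (\<forall>n\<ge>1. \<phi> n \<ge> 0) \<and>
      (\<forall>N\<ge>2. \<phi> (N ^ d) \<le> c * (if d = 2 then log 2 (real N) else 1))"
proof (cases "d = 2")
  case True
  define q :: real where "q = ln (3 / 2)"
  \<comment> \<open>For \<open>d = 2\<close> the exponent \<open>1 / d - 1 / 2\<close> is 0, so
    every generation costs 6; shrinking by 2/3 lowers the logarithm by at least
    \<open>q\<close>.\<close>
  define \<phi> where "\<phi> n = 6 / q * ln (real n)" for n :: nat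
  have l: "q > 0" by (simp add: q_def)
  have "\<phi> m + 6 * real n powr (1 / real d - 1 / 2) \<le> \<phi> n" if "1 \<le> m" "3 * m \<le> 2 * n" for m n :: nat
  proof -
    have "real (3 * m) \<le> real (2 * n)" using that(2) by (rule of_nat_mono)
    then have "ln (3 / 2 * real m) \<le> ln (real n)" using that(1) by (intro ln_mono) auto
    moreover have "ln (3 / 2 * real m) = q + ln (real m)"
      unfolding q_def using that(1) by (intro ln_mult_pos) auto
    ultimately have "6 / q * (q + ln (real m)) \<le> 6 / q * ln (real n)"
      using l by (intro mult_left_mono) auto
    moreover have "real n powr (1 / real d - 1 / 2) = 1" using that True by simp
    ultimately show ?thesis using l by (simp add: \<phi>_def distrib_left)
  qed
  moreover have "\<phi> n \<ge> 0" if "n \<ge> 1" for n using l that by (simp add: \<phi>_def)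
  \<comment> \<open>The factor 12 comes from \<open>ln (N\<^sup>2) = 2 * ln N\<close>; passing to
    base 2 only increases the logarithm because \<open>ln 2 \<le> 1\<close>.\<close>
  moreover have "\<phi> (N ^ d) \<le> 12 / q * (if d = 2 then log 2 (real N) else 1)" if N: "N \<ge> 2" for N
  proof -
    have "ln 2 \<le> (1 :: real)" using ln_le_minus_one[of "2 :: real"] by simp
    then have "ln (real N) \<le> log 2 (real N)" using N by (simp add: log_def le_divide_eq mult_left_le)
    then have "12 / q * ln (real N) \<le> 12 / q * log 2 (real N)"
      using l by (intro mult_left_mono) auto
    then show ?thesis using True N by (simp add: \<phi>_def ln_realpow)
  qed
  ultimately show ?thesis
    using l by (intro exI[of _ \<phi>] exI[of _ "12 / q"]) simp
next
  case False
  define \<beta> where "\<beta> = 1 / 2 - 1 / real d"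
  have \<beta>: "\<beta> > 0" using d False by (simp add: \<beta>_def field_simps)
  \<comment> \<open>If \<open>m \<le> 2 * n / 3\<close>, then \<open>m powr - \<beta>\<close>
    exceeds \<open>n powr - \<beta>\<close> by at least \<open>(3 / 2) powr \<beta> - 1\<close>
    times the latter; \<open>c\<close> turns this gain into 6.\<close>
  define c where "c = 6 / ((3 / 2) powr \<beta> - 1)"
  have g: "(3 / 2) powr \<beta> - 1 > 0" using \<beta> by (simp add: gr_one_powr)
  then have c: "c > 0" by (simp add: c_def)
  define \<phi> where "\<phi> n = c * (1 - real n powr - \<beta>)" for n :: nat
  have "\<phi> m + 6 * real n powr (1 / real d - 1 / 2) \<le> \<phi> n" if "1 \<le> m" "3 * m \<le> 2 * n" for m n :: nat
  proof -
    have n: "n > 0" using that by linarith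
    have "real (3 * m) \<le> real (2 * n)" using that(2) by (rule of_nat_mono)
    then have "real m \<le> real n / (3 / 2)" by simp
    then have "(real n / (3 / 2)) powr - \<beta> \<le> real m powr - \<beta>"
      using that(1) \<beta> by (intro powr_mono2') auto
    moreover have "(real n / (3 / 2)) powr - \<beta> = (3 / 2) powr \<beta> * real n powr - \<beta>"
      using n by (simp add: powr_divide powr_mult powr_minus field_simps)
    ultimately have "((3 / 2) powr \<beta> - 1) * real n powr - \<beta> \<le> real m powr - \<beta> - real n powr - \<beta>"
      by (simp add: left_diff_distrib)
    then have "c * (((3 / 2) powr \<beta> - 1) * real n powr - \<beta>) \<le> c * (real m powr - \<beta> - real n powr - \<beta>)"
      using c by (intro mult_left_mono) auto
    moreover have "c * (((3 / 2) powr \<beta> - 1) * real n powr - \<beta>) = 6 * real n powr - \<beta>"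
      using g \<beta> by (simp add: c_def)
    moreover have e: "1 / real d - 1 / 2 = - \<beta>" by (simp add: \<beta>_def)
    ultimately show ?thesis unfolding e \<phi>_def by (simp add: right_diff_distrib)
  qed
  moreover have "\<phi> n \<ge> 0" if "n \<ge> 1" for n
  proof -
    have "real n powr - \<beta> \<le> 1 powr - \<beta>" using that \<beta> by (intro powr_mono2') auto
    then show ?thesis using c by (simp add: \<phi>_def)
  qed
  moreover have "\<phi> (N ^ d) \<le> c * (if d = 2 then log 2 (real N) else 1)" for N
    using c False by (simp add: \<phi>_def)
  ultimately show ?thesis using c by (intro exI[of _ \<phi>] exI[of _ c]) simp
qed

section \<open>Descent directions of the total variation\<close>

lemma total_variation_cong:
  assumes "N \<ge> 1" "\<And>k. k \<in> grid d N \<Longrightarrow> f k = g k"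
  shows "total_variation d N f = total_variation d N g"
  unfolding total_variation_eq_local_tv[OF assms(1)] local_tv_def
  by (intro sum.cong) (auto simp: assms(2))

lemma grad_index_shift_in_grid:
  assumes "N \<ge> 1" "(i, k) \<in> grad_index d N"
  shows "i \<in> {1..d}" "k \<in> grid d N" "k(i := k i + 1) \<in> grid d N"
proof -
  show ik: "i \<in> {1..d}" "k \<in> grid d N" using assms(2) by (auto simp: grad_index_def)
  have "k i + 1 \<in> {1..N}" using assms by (auto simp: grad_index_def)
  then have "k(i := k i + 1) \<in> PiE (insert i {1..d}) (\<lambda>_. {1..N})"
    using ik(2) unfolding grid_def by (intro PiE_fun_upd) auto
  then show "k(i := k i + 1) \<in> grid d N" using ik(1) by (simp add: grid_def insert_absorb)
qed

lemma finite_grad_index: "finite (grad_index d N)"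
  by (rule finite_subset[of _ "{1..d} \<times> grid d N"]) (auto simp: grad_index_def)

text \<open>By \<open>(x - y)\<^sup>2 \<le> 2 * x\<^sup>2 + 2 * y\<^sup>2\<close>, and each grid
  point is the lower end of at most \<open>d\<close> edges and the upper end of at most
  \<open>d\<close>.\<close>

lemma sum_squares_discrete_gradient_le:
  assumes N: "N \<ge> 1"
  shows "(\<Sum>p\<in>grad_index d N. (discrete_gradient d N H p)\<^sup>2) \<le> 4 * real d * (\<Sum>k\<in>grid d N. (H k)\<^sup>2)"
proof -
  let ?I = "grad_index d N"
  let ?T = "{1..d} \<times> grid d N"
  let ?sh = "\<lambda>(i, k). (i, k(i := k i + 1)) :: nat \<times> multi_index"
  have T: "(\<Sum>(i, k)\<in>?T. (H k)\<^sup>2) = real d * (\<Sum>k\<in>grid d N. (H k)\<^sup>2)"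
    by (simp add: sum.cartesian_product[symmetric])
  have 1: "(\<Sum>(i, k)\<in>?I. (H k)\<^sup>2) \<le> (\<Sum>(i, k)\<in>?T. (H k)\<^sup>2)"
    by (intro sum_mono2) (auto simp: grad_index_def)
  \<comment> \<open>In a given direction an edge is determined by its upper end.\<close>
  have inj: "inj_on ?sh ?I"
  proof (rule inj_onI)
    fix p q assume "?sh p = ?sh q"
    moreover obtain i k j l where pq: "p = (i, k)" "q = (j, l)" by (cases p, cases q)
    ultimately have ij: "i = j" and eq: "k(i := k i + 1) = l(i := l i + 1)" by auto
    have "k x = l x" for x
      using fun_cong[OF eq, of x] by (cases "x = i") auto
    then show "p = q" using ij pq by auto
  qed
  have "(\<Sum>(i, k)\<in>?I. (H (k(i := k i + 1)))\<^sup>2) = (\<Sum>(i, k)\<in>?sh ` ?I. (H k)\<^sup>2)"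
    unfolding sum.reindex[OF inj] by (intro sum.cong) auto
  also have "\<dots> \<le> (\<Sum>(i, k)\<in>?T. (H k)\<^sup>2)"
    using grad_index_shift_in_grid[OF N] by (intro sum_mono2) auto
  finally have 2: "(\<Sum>(i, k)\<in>?I. (H (k(i := k i + 1)))\<^sup>2) \<le> (\<Sum>(i, k)\<in>?T. (H k)\<^sup>2)" .
  have sq: "(x - y)\<^sup>2 \<le> 2 * x\<^sup>2 + 2 * y\<^sup>2" for x y :: real
    using zero_le_power2[of "x + y"] by (simp add: power2_eq_square algebra_simps)
  have "(\<Sum>p\<in>?I. (discrete_gradient d N H p)\<^sup>2) = (\<Sum>(i, k)\<in>?I. (H (k(i := k i + 1)) - H k)\<^sup>2)"
    by (intro sum.cong) (auto simp: discrete_gradient_def)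
  also have "\<dots> \<le> (\<Sum>(i, k)\<in>?I. 2 * (H (k(i := k i + 1)))\<^sup>2 + 2 * (H k)\<^sup>2)"
    by (intro sum_mono) (auto intro: sq)
  also have "\<dots> = 2 * (\<Sum>(i, k)\<in>?I. (H (k(i := k i + 1)))\<^sup>2) + 2 * (\<Sum>(i, k)\<in>?I. (H k)\<^sup>2)"
    by (simp add: case_prod_unfold sum.distrib sum_distrib_left)
  also have "\<dots> \<le> 4 * (\<Sum>(i, k)\<in>?T. (H k)\<^sup>2)" using 1 2 by linarith
  finally show ?thesis unfolding T by simp
qed

text \<open>Off the support \<open>S\<close> of the gradient of \<open>X\<close>, adding
  \<open>H\<close> costs the full variation of \<open>H\<close>; on \<open>S\<close> it gains at
  most that of \<open>H\<close>. Hence at least half of the variation of \<open>H\<close> sits on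
  \<open>S\<close>, where Cauchy-Schwarz with at most \<open>K\<close> entries and the bound on the
  gradient apply.\<close>

lemma total_variation_descent_le:
  assumes N: "N \<ge> 1" and le: "total_variation d N (\<lambda>k. X k + H k) \<le> total_variation d N X"
    and K: "gradient_sparsity d N X \<le> K"
  shows "total_variation d N H \<le> 4 * sqrt (real d * real K) * sqrt (\<Sum>k\<in>grid d N. (H k)\<^sup>2)"
proof -
  let ?I = "grad_index d N"
  let ?D = "discrete_gradient d N"
  define S where "S = {p \<in> ?I. ?D X p \<noteq> 0}"
  have S: "S \<subseteq> ?I" "finite S" using finite_grad_index by (auto simp: S_def)
  have lin: "?D (\<lambda>k. X k + H k) p = ?D X p + ?D H p" if "p \<in> ?I" for p
    using that by (cases p) (simp add: discrete_gradient_def)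
  have "total_variation d N X + total_variation d N H - 2 * (\<Sum>p\<in>S. \<bar>?D H p\<bar>)
      = (\<Sum>p\<in>?I. \<bar>?D X p\<bar> + \<bar>?D H p\<bar> - 2 * (if p \<in> S then \<bar>?D H p\<bar> else 0))"
    using S by (simp add: total_variation_def sum.distrib sum_subtractf sum_distrib_left[symmetric]
        sum.If_cases finite_grad_index Int_absorb1)
  also have "\<dots> \<le> (\<Sum>p\<in>?I. \<bar>?D (\<lambda>k. X k + H k) p\<bar>)"
    by (intro sum_mono) (auto simp: S_def lin)
  also have "\<dots> \<le> total_variation d N X"
    using le by (simp add: total_variation_def)
  finally have "total_variation d N H \<le> 2 * (\<Sum>p\<in>S. \<bar>?D H p\<bar> * \<bar>1\<bar>)" by simp
  also have "\<dots> \<le> 2 * (L2_set (?D H) S * L2_set (\<lambda>_. 1) S)"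
    by (intro mult_left_mono L2_set_mult_ineq) auto
  also have "\<dots> \<le> 2 * (sqrt (4 * real d * (\<Sum>k\<in>grid d N. (H k)\<^sup>2)) * sqrt (real K))"
  proof (intro mult_left_mono mult_mono)
    have "(\<Sum>p\<in>S. (?D H p)\<^sup>2) \<le> (\<Sum>p\<in>?I. (?D H p)\<^sup>2)"
      using S finite_grad_index by (intro sum_mono2) auto
    also have "\<dots> \<le> 4 * real d * (\<Sum>k\<in>grid d N. (H k)\<^sup>2)" by (rule sum_squares_discrete_gradient_le[OF N])
    finally show "L2_set (?D H) S \<le> sqrt (4 * real d * (\<Sum>k\<in>grid d N. (H k)\<^sup>2))"
      unfolding L2_set_def by (rule real_sqrt_le_mono)
    show "L2_set (\<lambda>_. 1) S \<le> sqrt (real K)"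
      using K by (simp add: L2_set_def gradient_sparsity_def S_def)
  qed (auto intro!: mult_nonneg_nonneg sum_nonneg)
  also have "\<dots> = 4 * sqrt (real d * real K) * sqrt (\<Sum>k\<in>grid d N. (H k)\<^sup>2)"
    by (simp add: real_sqrt_mult)
  finally show ?thesis .
qed

section \<open>Kernels avoiding the box norm ball\<close>

text \<open>For the empty box, \<open>0 / 0 = 0\<close> makes the atom zero.\<close>

definition box_atom :: "multi_index set \<times> real \<Rightarrow> multi_index \<Rightarrow> real" where
  "box_atom = (\<lambda>(P, \<sigma>) x. \<sigma> * indicator P x / sqrt (card P))"

text \<open>With both signs present, the absolutely convex hull becomes a convex hull, as Maurey's
  method requires.\<close>

definition box_atoms :: "nat \<Rightarrow> nat \<Rightarrow> (multi_index set \<times> real) set" where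
  "box_atoms d N = boxes d N \<times> {-1, 1}"

lemma finite_box_atoms [simp]: "finite (box_atoms d N)"
  by (simp add: box_atoms_def)

lemma boxes_subset_grid: "P \<in> boxes d N \<Longrightarrow> P \<subseteq> grid d N"
  unfolding boxes_def by (auto dest: subsetD[OF grid_box_subset_grid])

lemma sum_indicator_grid:
  assumes "P \<in> boxes d N"
  shows "(\<Sum>x\<in>grid d N. (indicator P x :: real)\<^sup>2) = real (card P)"
proof -
  have "(\<Sum>x\<in>grid d N. (indicator P x :: real)\<^sup>2) = (\<Sum>x\<in>P. 1)"
    using boxes_subset_grid[OF assms] by (intro sum.mono_neutral_cong_right) auto
  then show ?thesis by simp
qed

text \<open>After normalising the indicators, the coefficients \<open>w P / R\<close> have absolute
  sum at most 1; their positive and negative parts become weights of the two signed atoms.\<close>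

lemma box_norm_le_convex_combination:
  assumes H: "box_norm_le d N H R" and R: "R > 0" and N: "N \<ge> 1"
  shows "\<exists>p. (\<forall>i\<in>box_atoms d N. p i \<ge> 0) \<and> sum p (box_atoms d N) = 1 \<and>
    (\<forall>x\<in>grid d N. H x = (\<Sum>i\<in>box_atoms d N. p i * (R * box_atom i x)))"
proof -
  let ?B = "boxes d N"
  obtain c where c: "\<And>k. k \<in> grid d N \<Longrightarrow> H k = (\<Sum>P\<in>?B. c P * indicator P k)"
      and cR: "(\<Sum>P\<in>?B. \<bar>c P\<bar> * sqrt (card P)) \<le> R"
    using H unfolding box_norm_le_def by blast
  define w where "w P = c P * sqrt (card P)" for P :: "multi_index set"
  have wR: "(\<Sum>P\<in>?B. \<bar>w P\<bar>) \<le> R" using cR by (simp add: w_def abs_mult)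
  have "(\<lambda>i\<in>{1..d}. 1) \<in> grid d N" using N by (auto simp: grid_def)
  then have "?B \<noteq> {}" using grid_box_in_boxes by blast
  define n where "n = real (card ?B)"
  have B: "n > 0" using \<open>?B \<noteq> {}\<close> by (simp add: n_def card_gt_0_iff)
  \<comment> \<open>The unused mass \<open>1 - \<parallel>w\<parallel>\<^sub>1 / R\<close> is spread evenly, so that opposite atoms cancel.\<close>
  define e where "e = (1 - (\<Sum>P\<in>?B. \<bar>w P\<bar>) / R) / (2 * n)"
  have e: "e \<ge> 0" using wR R B by (simp add: e_def)
  \<comment> \<open>\<open>(\<bar>w P\<bar> + \<sigma> * w P) / 2\<close> is the positive part of
    \<open>w P\<close> for \<open>\<sigma> = 1\<close> and the negative part for
    \<open>\<sigma> = -1\<close>.\<close>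
  define p where "p = (\<lambda>(P, \<sigma>). (\<bar>w P\<bar> + \<sigma> * w P) / (2 * R) + e)"
  have sum_I: "sum f (box_atoms d N) = (\<Sum>P\<in>?B. f (P, -1) + f (P, 1))" for f :: "_ \<Rightarrow> real"
  proof -
    have "sum f (box_atoms d N) = (\<Sum>P\<in>?B. \<Sum>\<sigma>\<in>{-1, 1}. f (P, \<sigma>))"
      unfolding box_atoms_def by (simp only: sum.cartesian_product case_prod_eta)
    then show ?thesis by simp
  qed
  have "p i \<ge> 0" if "i \<in> box_atoms d N" for i
  proof -
    obtain P \<sigma> where i: "i = (P, \<sigma>)" "\<sigma> \<in> {-1, 1}" using \<open>i \<in> box_atoms d N\<close> by (auto simp: box_atoms_def)
    then have "0 \<le> \<bar>w P\<bar> + \<sigma> * w P" using abs_ge_minus_self[of "w P"] by auto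
    then show ?thesis using e R by (simp add: i p_def)
  qed
  moreover have "sum p (box_atoms d N) = 1"
  proof -
    have "sum p (box_atoms d N) = (\<Sum>P\<in>?B. \<bar>w P\<bar> / R + 2 * e)"
      unfolding sum_I using R by (intro sum.cong) (auto simp: p_def field_simps)
    also have "\<dots> = (\<Sum>P\<in>?B. \<bar>w P\<bar>) / R + n * (2 * e)"
      by (simp add: sum.distrib sum_divide_distrib n_def)
    also have "n * (2 * e) = 1 - (\<Sum>P\<in>?B. \<bar>w P\<bar>) / R" using B by (simp add: e_def)
    finally show ?thesis by simp
  qed
  moreover have "H x = (\<Sum>i\<in>box_atoms d N. p i * (R * box_atom i x))" if "x \<in> grid d N" for x
  proof -
    have "p (P, -1) * (R * box_atom (P, -1) x) + p (P, 1) * (R * box_atom (P, 1) x) = c P * indicator P x"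
      if "P \<in> ?B" for P
    proof (cases "x \<in> P")
      case True
      \<comment> \<open>The factor \<open>sqrt (card P)\<close> in \<open>w\<close> must cancel
        against the one in the atom.\<close>
      then have "card P \<noteq> 0" using finite_boxes_elem[OF that] by auto
      then show ?thesis using R True by (simp add: p_def box_atom_def w_def field_simps)
    qed (simp add: box_atom_def)
    then show ?thesis unfolding sum_I c[OF that] by simp
  qed
  ultimately show ?thesis by blast
qed

text \<open>Suppose \<open>A H = 0\<close>. Maurey's method yields a sum \<open>y\<close> of
  \<open>k\<close> atoms with \<open>R * y\<close> within \<open>k / 6\<close> of
  \<open>k * H\<close>, and with the scaled image of \<open>R * y\<close> of norm at most
  \<open>k / 6\<close>. The lower bound for \<open>A\<close> then forces \<open>R * y\<close> to
  have norm at most \<open>4 * k / 6\<close>, so \<open>k * H\<close> has norm at most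
  \<open>5 * k / 6\<close> instead of \<open>k\<close>.\<close>

lemma kernel_avoids_box_norm_ball:
  fixes A :: grid_matrix
  assumes H: "box_norm_le d N H R" and R: "R > 0" and N: "N \<ge> 1" and M: "M \<ge> 1"
    and H1: "(\<Sum>x\<in>grid d N. (H x)\<^sup>2) = 1" and k: "180 * R\<^sup>2 \<le> real k"
    and upper: "\<And>P. P \<in> boxes d N \<Longrightarrow> P \<noteq> {} \<Longrightarrow>
      (\<Sum>m\<in>{1..M}. (\<Sum>x\<in>grid d N. A (m, x) * indicator P x)\<^sup>2) \<le> 4 * real M * real (card P)"
    and lower: "\<And>s. s \<in> {..<k} \<rightarrow>\<^sub>E box_atoms d N \<Longrightarrow>
      (\<Sum>m\<in>{1..M}. (\<Sum>x\<in>grid d N. A (m, x) * (\<Sum>j<k. box_atom (s j) x))\<^sup>2)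
        \<ge> real M / 16 * (\<Sum>x\<in>grid d N. (\<Sum>j<k. box_atom (s j) x)\<^sup>2)"
  shows "\<exists>m\<in>{1..M}. (\<Sum>x\<in>grid d N. A (m, x) * H x) \<noteq> 0"
proof (rule ccontr)
  assume "\<not> ?thesis"
  then have ker: "(\<Sum>x\<in>grid d N. A (m, x) * H x) = 0" if "m \<in> {1..M}" for m using that by blast
  let ?G = "grid d N"
  let ?I = "box_atoms d N"
  obtain p where p: "\<And>i. i \<in> ?I \<Longrightarrow> p i \<ge> 0" "sum p ?I = 1"
    and Hp: "\<And>x. x \<in> ?G \<Longrightarrow> H x = (\<Sum>i\<in>?I. p i * (R * box_atom i x))"
    using box_norm_le_convex_combination[OF H R N] by blast
  define T where "T f m = (\<Sum>x\<in>?G. A (m, x) * f x) / sqrt (real M)" for f :: "multi_index \<Rightarrow> real" and m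
  \<comment> \<open>One vector records the scaled atom and its image under \<open>A\<close>, so that Maurey's method controls both errors.\<close>
  define u where "u i = case_sum (\<lambda>x. R * box_atom i x) (\<lambda>m. R * T (box_atom i) m)" for i
  let ?\<Lambda> = "?G <+> {1..M}"
  have sum\<Lambda>: "sum f ?\<Lambda> = (\<Sum>x\<in>?G. f (Inl x)) + (\<Sum>m\<in>{1..M}. f (Inr m))" for f :: "_ \<Rightarrow> real"
    by (subst sum.Plus) (auto simp: comp_def)
  \<comment> \<open>The atom itself contributes \<open>R\<^sup>2\<close>, its image at most
    \<open>4 * R\<^sup>2\<close> by the upper bound on boxes.\<close>
  have b: "(\<Sum>l\<in>?\<Lambda>. (u i l)\<^sup>2) \<le> 5 * R\<^sup>2" if i: "i \<in> ?I" for i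
  proof -
    obtain P \<sigma> where iP: "i = (P, \<sigma>)" "P \<in> boxes d N" and \<sigma>: "\<sigma>\<^sup>2 = 1"
      using i by (cases i) (auto simp: box_atoms_def)
    show ?thesis
    proof (cases "P = {}")
      case True
      then show ?thesis using R unfolding sum\<Lambda> by (simp add: u_def iP box_atom_def T_def)
    next
      case False
      then have cP: "real (card P) > 0" using finite_boxes_elem[OF iP(2)] by (simp add: card_gt_0_iff)
      have "(\<Sum>x\<in>?G. (R * box_atom i x)\<^sup>2) = R\<^sup>2 * ((\<Sum>x\<in>?G. (indicator P x)\<^sup>2) / real (card P))"
        using \<sigma> by (simp add: iP box_atom_def power_mult_distrib power_divide sum_distrib_left sum_divide_distrib)
      also have "\<dots> = R\<^sup>2" using cP by (simp add: sum_indicator_grid[OF iP(2)])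
      finally have 1: "(\<Sum>x\<in>?G. (R * box_atom i x)\<^sup>2) = R\<^sup>2" .
      define W where "W m = (\<Sum>x\<in>?G. A (m, x) * indicator P x)" for m
      have Ti: "T (box_atom i) m = \<sigma> * W m / sqrt (card P) / sqrt M" for m
        unfolding W_def T_def iP box_atom_def prod.case sum_distrib_left sum_divide_distrib
        by (intro sum.cong refl) (simp add: mult_ac)
      have "(\<Sum>m\<in>{1..M}. (R * T (box_atom i) m)\<^sup>2)
          = R\<^sup>2 * ((\<Sum>m\<in>{1..M}. (W m)\<^sup>2) / (real (card P) * real M))"
        using \<sigma> unfolding Ti by (simp add: power_mult_distrib power_divide sum_distrib_left sum_divide_distrib)
      also have "\<dots> \<le> R\<^sup>2 * 4"
        using upper[OF iP(2) False, folded W_def] cP M by (intro mult_left_mono) (auto simp: divide_le_eq mult_ac)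
      finally show ?thesis using 1 unfolding sum\<Lambda> by (simp add: u_def)
    qed
  qed
  obtain s where s: "s \<in> {..<k} \<rightarrow>\<^sub>E ?I"
    and le: "(\<Sum>l\<in>?\<Lambda>. (real k * (\<Sum>i\<in>?I. p i * u i l) - (\<Sum>j<k. u (s j) l))\<^sup>2) \<le> real k * (5 * R\<^sup>2)"
    using maurey[of ?I p u ?\<Lambda> "5 * R\<^sup>2" k] p b by auto
  define y where "y x = (\<Sum>j<k. box_atom (s j) x)" for x
  have hl: "(\<Sum>i\<in>?I. p i * u i (Inl x)) = H x" if "x \<in> ?G" for x
    using Hp[OF that] by (simp add: u_def)
  \<comment> \<open>The image part of the target is \<open>A H\<close> up to scaling, hence zero, so
    the error in these coordinates is the image of \<open>R * y\<close> itself.\<close>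
  have hr: "(\<Sum>i\<in>?I. p i * u i (Inr m)) = 0" if m: "m \<in> {1..M}" for m
  proof -
    have "(\<Sum>i\<in>?I. p i * u i (Inr m)) = (\<Sum>i\<in>?I. \<Sum>x\<in>?G. A (m, x) * (p i * (R * box_atom i x)) / sqrt (real M))"
      by (simp add: u_def T_def sum_distrib_left sum_divide_distrib mult_ac)
    also have "\<dots> = (\<Sum>x\<in>?G. A (m, x) * H x) / sqrt (real M)"
      by (subst sum.swap) (simp add: Hp sum_distrib_left sum_divide_distrib)
    finally show ?thesis using ker[OF m] by simp
  qed
  have yl: "(\<Sum>j<k. u (s j) (Inl x)) = R * y x" for x
    by (simp add: u_def y_def sum_distrib_left)
  have yr: "(\<Sum>j<k. u (s j) (Inr m)) = R * T y m" for m
  proof -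
    have "(\<Sum>j<k. u (s j) (Inr m)) = (\<Sum>j<k. \<Sum>x\<in>?G. R * (A (m, x) * box_atom (s j) x) / sqrt (real M))"
      by (simp add: u_def T_def sum_distrib_left sum_divide_distrib)
    also have "\<dots> = R * T y m"
      by (subst sum.swap) (simp add: T_def y_def sum_distrib_left sum_divide_distrib)
    finally show ?thesis .
  qed
  have "(\<Sum>x\<in>?G. (real k * H x - R * y x)\<^sup>2) + (\<Sum>m\<in>{1..M}. (R * T y m)\<^sup>2) \<le> real k * (5 * R\<^sup>2)"
    using le unfolding sum\<Lambda> yl yr by (simp add: hl hr)
  \<comment> \<open>Here \<open>180 = 5 * 36\<close> enters.\<close>
  also have "\<dots> \<le> real k * (real k / 36)"
    using k by (intro mult_left_mono) auto
  finally have both: "(\<Sum>x\<in>?G. (real k * H x - R * y x)\<^sup>2) + (\<Sum>m\<in>{1..M}. (R * T y m)\<^sup>2) \<le> (real k / 6)\<^sup>2"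
    by (simp add: power2_eq_square)
  define a where "a = L2_set (\<lambda>x. R * y x) ?G"
  have a2: "a\<^sup>2 = R\<^sup>2 * (\<Sum>x\<in>?G. (y x)\<^sup>2)"
    unfolding a_def L2_set_def by (simp add: sum_nonneg power_mult_distrib sum_distrib_left)
  have "a\<^sup>2 / 16 = R\<^sup>2 / real M * (real M / 16 * (\<Sum>x\<in>?G. (y x)\<^sup>2))"
    using M by (simp add: a2)
  also have "\<dots> \<le> R\<^sup>2 / real M * (\<Sum>m\<in>{1..M}. (\<Sum>x\<in>?G. A (m, x) * y x)\<^sup>2)"
    using lower[OF s] unfolding y_def by (intro mult_left_mono) auto
  also have "\<dots> = (\<Sum>m\<in>{1..M}. (R * T y m)\<^sup>2)"
    unfolding sum_distrib_left[where A = "{1..M}"]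
    by (intro sum.cong refl) (simp add: T_def power_mult_distrib power_divide)
  also have "\<dots> \<le> (real k / 6)\<^sup>2"
    using both by (smt (verit) sum_nonneg zero_le_power2)
  finally have "a\<^sup>2 \<le> (4 * (real k / 6))\<^sup>2" by (simp add: power2_eq_square)
  then have a_le: "a \<le> 4 * (real k / 6)" by (rule power2_le_imp_le) simp
  \<comment> \<open>The triangle inequality combines the approximation error \<open>k / 6\<close>
    with the norm \<open>a\<close> of \<open>R * y\<close>.\<close>
  have "L2_set (\<lambda>x. real k * H x) ?G = L2_set (\<lambda>x. (real k * H x - R * y x) + R * y x) ?G" by simp
  also have "\<dots> \<le> L2_set (\<lambda>x. real k * H x - R * y x) ?G + a"
    unfolding a_def by (rule L2_set_triangle_ineq)
  also have "L2_set (\<lambda>x. real k * H x - R * y x) ?G \<le> real k / 6"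
  proof -
    have "0 \<le> (\<Sum>m\<in>{1..M}. (R * T y m)\<^sup>2)" by (rule sum_nonneg) simp
    then show ?thesis
      unfolding L2_set_def using both by (intro real_le_lsqrt) (auto intro: sum_nonneg)
  qed
  finally have "L2_set (\<lambda>x. real k * H x) ?G \<le> real k / 6 + a" by simp
  moreover have "L2_set (\<lambda>x. real k * H x) ?G = real k"
    by (simp add: L2_set_def power_mult_distrib sum_distrib_left[symmetric] H1)
  moreover have "real k > 0"
    using k R by (smt (verit) zero_less_power mult_pos_pos)
  ultimately show False using a_le by linarith
qed

section \<open>Exact recovery\<close>

text \<open>The failure event in terms of the difference \<open>H\<close> between a competitor and
  \<open>X\<close>. The weak inequality includes ties, that is, failure of uniqueness.\<close>

definition descent_kernel_event ::
    "nat \<Rightarrow> nat \<Rightarrow> nat \<Rightarrow> (multi_index \<Rightarrow> real) \<Rightarrow> grid_matrix set" where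
  "descent_kernel_event d N M X = {A \<in> space (gaussian_matrix d N M).
     \<exists>H \<in> grid d N \<rightarrow>\<^sub>E UNIV. (\<exists>k\<in>grid d N. H k \<noteq> 0) \<and>
       (\<forall>m\<in>{1..M}. (\<Sum>k\<in>grid d N. A (m, k) * H k) = 0) \<and>
       total_variation d N (\<lambda>k. X k + H k) \<le> total_variation d N X}"

lemma descent_kernel_event_measurable:
  assumes N: "N \<ge> 1"
  shows "descent_kernel_event d N M X \<in> sets (gaussian_matrix d N M)"
  unfolding descent_kernel_event_def
proof (rule kernel_event_measurable)
  fix p assume "p \<in> {1..M} \<times> grid d N"
  then show "(\<lambda>A. A p) \<in> borel_measurable (gaussian_matrix d N M)"
    using measurable_component_singleton[of p "{1..M} \<times> grid d N" "\<lambda>_. std_normal"]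
    unfolding gaussian_matrix_def by simp
next
  fix S :: "nat \<Rightarrow> multi_index \<Rightarrow> real" and l
  assume lim: "\<And>k. k \<in> grid d N \<Longrightarrow> (\<lambda>n. S n k) \<longlonglongrightarrow> l k"
  show "(\<lambda>n. total_variation d N (\<lambda>k. X k + S n k)) \<longlonglongrightarrow> total_variation d N (\<lambda>k. X k + l k)"
    unfolding total_variation_def
  proof (intro tendsto_sum tendsto_rabs)
    fix p assume p: "p \<in> grad_index d N"
    obtain i k where ik: "p = (i, k)" by (cases p)
    show "(\<lambda>n. discrete_gradient d N (\<lambda>k. X k + S n k) p) \<longlonglongrightarrow> discrete_gradient d N (\<lambda>k. X k + l k) p"
      using p grad_index_shift_in_grid[OF N p[unfolded ik]] unfolding ik discrete_gradient_def
      by (auto intro!: tendsto_intros lim)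
  qed
qed auto

text \<open>\<open>X\<close> is feasible, and feasible \<open>V\<close> correspond to kernel vectors
  \<open>V - X\<close>. Grid vectors are extensional, so \<open>V \<noteq> X\<close> means that the
  difference is nonzero at some grid point.\<close>

lemma tv_minimizers_eq_singleton_iff:
  assumes N: "N \<ge> 1" and X: "X \<in> grid_vectors d N" and A: "A \<in> space (gaussian_matrix d N M)"
  shows "tv_minimizers d N M A (apply_matrix d N M A X) = {X} \<longleftrightarrow> A \<notin> descent_kernel_event d N M X"
proof -
  let ?G = "grid d N"
  define F where "F V \<longleftrightarrow> V \<in> grid_vectors d N \<and> apply_matrix d N M A X = apply_matrix d N M A V" for V
  have min: "tv_minimizers d N M A (apply_matrix d N M A X)
      = {U. F U \<and> (\<forall>V. F V \<longrightarrow> total_variation d N U \<le> total_variation d N V)}"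
    unfolding tv_minimizers_def is_arg_min_def F_def by (auto simp: not_less)
  have FX: "F X" using X by (simp add: F_def)
  have F_iff: "F V \<longleftrightarrow> V \<in> grid_vectors d N \<and> (\<forall>m\<in>{1..M}. (\<Sum>k\<in>?G. A (m, k) * (V k - X k)) = 0)" for V
  proof -
    have "apply_matrix d N M A X = apply_matrix d N M A V
        \<longleftrightarrow> (\<forall>m\<in>{1..M}. (\<Sum>k\<in>?G. A (m, k) * X k) = (\<Sum>k\<in>?G. A (m, k) * V k))"
      unfolding apply_matrix_def by (auto simp: fun_eq_iff restrict_def)
    also have "\<dots> \<longleftrightarrow> (\<forall>m\<in>{1..M}. (\<Sum>k\<in>?G. A (m, k) * (V k - X k)) = 0)"
      by (auto simp: right_diff_distrib sum_subtractf)
    finally show ?thesis by (auto simp: F_def)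
  qed
  show ?thesis
  proof
    assume sing: "tv_minimizers d N M A (apply_matrix d N M A X) = {X}"
    show "A \<notin> descent_kernel_event d N M X"
    proof
      assume "A \<in> descent_kernel_event d N M X"
      then obtain H k0 where H: "k0 \<in> ?G" "H k0 \<noteq> 0"
          "\<And>m. m \<in> {1..M} \<Longrightarrow> (\<Sum>k\<in>?G. A (m, k) * H k) = 0"
          "total_variation d N (\<lambda>k. X k + H k) \<le> total_variation d N X"
        unfolding descent_kernel_event_def by blast
      define V where "V = (\<lambda>k\<in>?G. X k + H k)"
      have "(\<Sum>k\<in>?G. A (m, k) * (V k - X k)) = (\<Sum>k\<in>?G. A (m, k) * H k)" for m
        by (intro sum.cong) (auto simp: V_def)
      then have "F V" using H(3) unfolding F_iff by (auto simp: V_def grid_vectors_def)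
      moreover have "total_variation d N V = total_variation d N (\<lambda>k. X k + H k)"
        by (intro total_variation_cong N) (simp add: V_def)
      then have "total_variation d N V \<le> total_variation d N X" using H(4) by simp
      moreover have "X \<in> tv_minimizers d N M A (apply_matrix d N M A X)" using sing by simp
      \<comment> \<open>\<open>X\<close> is a minimiser and \<open>V\<close> is feasible with no
        larger variation, so \<open>V\<close> is a second minimiser.\<close>
      ultimately have "V \<in> tv_minimizers d N M A (apply_matrix d N M A X)"
        unfolding min by (auto intro: order_trans)
      then have "V = X" using sing by simp
      then have "V k0 = X k0" by simp
      then show False using H(1,2) by (simp add: V_def)
    qed
  next
    assume notin: "A \<notin> descent_kernel_event d N M X"
    have lt: "total_variation d N X < total_variation d N V" if V: "F V" "V \<noteq> X" for V
    proof (rule ccontr)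
      assume "\<not> ?thesis"
      then have le: "total_variation d N V \<le> total_variation d N X" by simp
      define H where "H = (\<lambda>k\<in>?G. V k - X k)"
      have "V \<in> grid_vectors d N" using V by (simp add: F_def)
      then have "\<exists>k\<in>?G. V k \<noteq> X k"
        using X V(2) unfolding grid_vectors_def by (metis PiE_ext)
      then have "\<exists>k\<in>?G. H k \<noteq> 0" by (auto simp: H_def)
      moreover have "(\<Sum>k\<in>?G. A (m, k) * H k) = (\<Sum>k\<in>?G. A (m, k) * (V k - X k))" for m
        by (intro sum.cong) (auto simp: H_def)
      then have "\<forall>m\<in>{1..M}. (\<Sum>k\<in>?G. A (m, k) * H k) = 0" using V(1) unfolding F_iff by simp
      moreover have "total_variation d N (\<lambda>k. X k + H k) = total_variation d N V"
        by (intro total_variation_cong N) (simp add: H_def)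
      then have "total_variation d N (\<lambda>k. X k + H k) \<le> total_variation d N X" using le by simp
      moreover have "H \<in> ?G \<rightarrow>\<^sub>E UNIV" by (simp add: H_def)
      ultimately have "A \<in> descent_kernel_event d N M X"
        using A unfolding descent_kernel_event_def by blast
      then show False using notin by simp
    qed
    show "tv_minimizers d N M A (apply_matrix d N M A X) = {X}"
    proof (intro set_eqI iffI)
      fix U assume "U \<in> tv_minimizers d N M A (apply_matrix d N M A X)"
      then have "F U" "total_variation d N U \<le> total_variation d N X" using FX unfolding min by auto
      then show "U \<in> {X}" using lt[of U] by fastforce
    next
      fix U assume "U \<in> {X}"
      then show "U \<in> tv_minimizers d N M A (apply_matrix d N M A X)"
        unfolding min using FX lt by (auto intro: less_imp_le)
    qed
  qed
qed

text \<open>A descent direction, scaled to Euclidean norm 1, has variation at most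
  \<open>4 * sqrt (d * K)\<close> and hence box norm at most \<open>R\<close>. It can lie in the
  kernel only if an upper tail event for a box or a lower tail event for a sum of \<open>k\<close>
  atoms occurs, and the union bound counts these.\<close>

lemma measure_descent_kernel_event_le:
  fixes \<phi> :: "nat \<Rightarrow> real" and R :: real
  assumes \<phi>: "\<And>m n. 1 \<le> m \<Longrightarrow> 3 * m \<le> 2 * n \<Longrightarrow> \<phi> m + 6 * real n powr (1 / real d - 1 / 2) \<le> \<phi> n"
    and \<phi>0: "\<And>n. n \<ge> 1 \<Longrightarrow> \<phi> n \<ge> 0" and d: "d \<ge> 1" and N: "N \<ge> 2" and M: "M \<ge> 1"
    and K: "gradient_sparsity d N X \<le> K"
    and R: "1 + \<phi> (N ^ d) * (4 * sqrt (real d * real K)) \<le> R" and k: "180 * R\<^sup>2 \<le> real k"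
  shows "measure (gaussian_matrix d N M) (descent_kernel_event d N M X)
    \<le> real N ^ ((2 * d + 1) * k + 1) * (9 / 10) ^ M"
proof -
  let ?P = "gaussian_matrix d N M"
  let ?G = "grid d N"
  let ?I = "box_atoms d N"
  have N1: "N \<ge> 1" using N by simp
  have psn: "prob_space std_normal"
    using prob_space_normal_density[of 1 0] by simp
  interpret P: prob_space ?P
    unfolding gaussian_matrix_def by (intro prob_space_PiM psn)
  have "0 \<le> \<phi> (N ^ d) * (4 * sqrt (real d * real K))"
    using N by (intro mult_nonneg_nonneg \<phi>0) auto
  then have R1: "R \<ge> 1" using R by linarith
  then have "R\<^sup>2 \<ge> 1" by simp
  then have k1: "k \<ge> 1" using k by (cases k) auto
  define Z where "Z A y = (\<Sum>m\<in>{1..M}. (\<Sum>x\<in>?G. A (m, x) * y x)\<^sup>2)"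
    for A :: grid_matrix and y :: "multi_index \<Rightarrow> real"
  have Z_meas[measurable]: "(\<lambda>A. Z A y) \<in> borel_measurable ?P" for y
    unfolding Z_def gaussian_matrix_def by (rule borel_measurable_image_norm)
  define Y where "Y s x = (\<Sum>j<k. box_atom (s j) x)" for s :: "nat \<Rightarrow> multi_index set \<times> real" and x
  \<comment> \<open>The tail bounds need a nonzero vector; for sums of atoms that cancel to 0 the
    lower bound is trivial.\<close>
  define S where "S = {s \<in> {..<k} \<rightarrow>\<^sub>E ?I. (\<Sum>x\<in>?G. (Y s x)\<^sup>2) > 0}"
  define Q where "Q = boxes d N - {{}}"
  define E1 where "E1 P = {A \<in> space ?P. Z A (indicator P) \<ge> 4 * real M * real (card P)}" for P
  define E2 where "E2 s = {A \<in> space ?P. Z A (Y s) \<le> real M / 16 * (\<Sum>x\<in>?G. (Y s x)\<^sup>2)}" for s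
  have finS: "finite S" unfolding S_def by (simp add: finite_PiE)
  have finQ: "finite Q" unfolding Q_def by simp
  have sub: "descent_kernel_event d N M X \<subseteq> (\<Union>P\<in>Q. E1 P) \<union> (\<Union>s\<in>S. E2 s)"
  proof
    fix A assume A: "A \<in> descent_kernel_event d N M X"
    show "A \<in> (\<Union>P\<in>Q. E1 P) \<union> (\<Union>s\<in>S. E2 s)"
    proof (rule ccontr)
      assume notin: "A \<notin> (\<Union>P\<in>Q. E1 P) \<union> (\<Union>s\<in>S. E2 s)"
      from A obtain H k0 where As: "A \<in> space ?P" and H: "k0 \<in> ?G" "H k0 \<noteq> 0"
          "\<And>m. m \<in> {1..M} \<Longrightarrow> (\<Sum>k\<in>?G. A (m, k) * H k) = 0"
          "total_variation d N (\<lambda>k. X k + H k) \<le> total_variation d N X"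
        unfolding descent_kernel_event_def by blast
      define r where "r = sqrt (\<Sum>x\<in>?G. (H x)\<^sup>2)"
      have sq: "(\<Sum>x\<in>?G. (H x)\<^sup>2) > 0" using H(1,2) by (intro sum_pos2[of ?G k0]) auto
      then have r: "r > 0" "r\<^sup>2 = (\<Sum>x\<in>?G. (H x)\<^sup>2)" by (auto simp: r_def)
      define h where "h x = H x / r" for x
      have h1: "(\<Sum>x\<in>?G. (h x)\<^sup>2) = 1"
        using r sq by (simp add: h_def power_divide sum_divide_distrib[symmetric])
      have tvh: "total_variation d N h = total_variation d N H / r"
      proof -
        have "discrete_gradient d N h p = discrete_gradient d N H p / r" if "p \<in> grad_index d N" for p
          using that by (cases p) (simp add: discrete_gradient_def h_def diff_divide_distrib)
        then show ?thesis using r by (simp add: total_variation_def sum_divide_distrib)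
      qed
      have "total_variation d N H \<le> 4 * sqrt (real d * real K) * r"
        unfolding r_def by (rule total_variation_descent_le[OF N1 H(4) K])
      then have "total_variation d N h \<le> 4 * sqrt (real d * real K)"
        using r unfolding tvh by (simp add: divide_le_eq)
      then have "\<phi> (N ^ d) * total_variation d N h \<le> \<phi> (N ^ d) * (4 * sqrt (real d * real K))"
        using N by (intro mult_left_mono \<phi>0) auto
      then have le: "sqrt (\<Sum>x\<in>?G. (h x)\<^sup>2) + \<phi> (N ^ d) * total_variation d N h \<le> R"
        using R h1 by simp
      have bn: "box_norm_le d N h R"
        by (rule box_norm_le_mono[OF box_norm_le_total_variation[OF \<phi> \<phi>0 d N1] le]) auto
      have "\<exists>m\<in>{1..M}. (\<Sum>x\<in>?G. A (m, x) * h x) \<noteq> 0"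
      proof (rule kernel_avoids_box_norm_ball[OF bn _ N1 M h1 k])
        show "R > 0" using R1 by simp
        fix P assume "P \<in> boxes d N" "P \<noteq> {}"
        then have "A \<notin> E1 P" using notin by (auto simp: Q_def)
        then show "(\<Sum>m\<in>{1..M}. (\<Sum>x\<in>?G. A (m, x) * indicator P x)\<^sup>2) \<le> 4 * real M * real (card P)"
          using As by (auto simp: E1_def Z_def)
      next
        fix s assume s: "s \<in> {..<k} \<rightarrow>\<^sub>E ?I"
        show "real M / 16 * (\<Sum>x\<in>?G. (\<Sum>j<k. box_atom (s j) x)\<^sup>2)
            \<le> (\<Sum>m\<in>{1..M}. (\<Sum>x\<in>?G. A (m, x) * (\<Sum>j<k. box_atom (s j) x))\<^sup>2)"
        proof (cases "(\<Sum>x\<in>?G. (Y s x)\<^sup>2) > 0")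
          case True
          then have "A \<notin> E2 s" using notin s by (auto simp: S_def)
          then show ?thesis using As by (auto simp: E2_def Z_def Y_def)
        next
          case False
          then have "(\<Sum>x\<in>?G. (Y s x)\<^sup>2) = 0"
            using sum_nonneg[of ?G "\<lambda>x. (Y s x)\<^sup>2"] by simp
          then show ?thesis unfolding Y_def by (simp add: sum_nonneg)
        qed
      qed
      then obtain m where m: "m \<in> {1..M}" "(\<Sum>x\<in>?G. A (m, x) * h x) \<noteq> 0" by blast
      have "(\<Sum>x\<in>?G. A (m, x) * h x) = (\<Sum>x\<in>?G. A (m, x) * H x) / r"
        by (simp add: h_def sum_divide_distrib)
      then show False using m H(3)[OF m(1)] by simp
    qed
  qed
  have E1s: "E1 P \<in> sets ?P" for P unfolding E1_def by measurable
  have E2s: "E2 s \<in> sets ?P" for s unfolding E2_def by measurable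
  have m1: "measure ?P (E1 P) \<le> (9 / 10) ^ M" if "P \<in> Q" for P
  proof -
    have P: "P \<in> boxes d N" "P \<noteq> {}" using that by (auto simp: Q_def)
    then have "(\<Sum>x\<in>?G. (indicator P x :: real)\<^sup>2) > 0"
      unfolding sum_indicator_grid[OF P(1)] using finite_boxes_elem[OF P(1)] by (simp add: card_gt_0_iff)
    from gaussian_image_norm_tails(2)[of "{1..M}", OF _ _ _ this] M
    show ?thesis by (simp add: E1_def Z_def gaussian_matrix_def sum_indicator_grid[OF P(1)])
  qed
  have m2: "measure ?P (E2 s) \<le> (9 / 10) ^ M" if "s \<in> S" for s
  proof -
    have "(\<Sum>x\<in>?G. (Y s x)\<^sup>2) > 0" using that by (simp add: S_def)
    from gaussian_image_norm_tails(1)[of "{1..M}", OF _ _ _ this] M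
    show ?thesis by (simp add: E2_def Z_def gaussian_matrix_def)
  qed
  have "measure ?P (descent_kernel_event d N M X) \<le> measure ?P ((\<Union>P\<in>Q. E1 P) \<union> (\<Union>s\<in>S. E2 s))"
    using finQ finS by (intro P.finite_measure_mono sub) (auto intro!: sets.finite_UN E1s E2s)
  also have "\<dots> \<le> measure ?P (\<Union>P\<in>Q. E1 P) + measure ?P (\<Union>s\<in>S. E2 s)"
    using finQ finS by (intro measure_Un_le) (auto intro!: sets.finite_UN E1s E2s)
  also have "\<dots> \<le> (\<Sum>P\<in>Q. measure ?P (E1 P)) + (\<Sum>s\<in>S. measure ?P (E2 s))"
    using E1s E2s by (intro add_mono measure_UNION_le finQ finS) auto
  also have "\<dots> \<le> real (card Q) * (9 / 10) ^ M + real (card S) * (9 / 10) ^ M"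
    by (intro add_mono sum_bounded_above m1 m2)
  also have "\<dots> = (real (card Q) + real (card S)) * (9 / 10) ^ M"
    by (simp add: distrib_right)
  also have "\<dots> \<le> real N ^ ((2 * d + 1) * k + 1) * (9 / 10) ^ M"
  proof (intro mult_right_mono)
    have cI: "card ?I \<le> N ^ (2 * d + 1)"
    proof -
      have "card ?I = card (boxes d N) * 2" by (simp add: box_atoms_def card_cartesian_product)
      also have "\<dots> \<le> N ^ (2 * d) * N" using card_boxes_le N by (intro mult_mono) auto
      finally show ?thesis by (simp add: mult.commute)
    qed
    have "card S \<le> card ({..<k} \<rightarrow>\<^sub>E ?I)" by (rule card_mono) (auto simp: S_def finite_PiE)
    also have "\<dots> = card ?I ^ k" by (simp add: card_PiE)
    also have "\<dots> \<le> (N ^ (2 * d + 1)) ^ k" by (rule power_mono[OF cI]) simp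
    also have "\<dots> = N ^ ((2 * d + 1) * k)" by (simp only: power_mult)
    finally have cS: "card S \<le> N ^ ((2 * d + 1) * k)" .
    have "card Q \<le> card (boxes d N)" unfolding Q_def by (intro card_mono) auto
    also have "\<dots> \<le> N ^ (2 * d)" by (rule card_boxes_le)
    \<comment> \<open>This needs \<open>k \<ge> 1\<close>, which follows from
      \<open>R \<ge> 1\<close>.\<close>
    also have "\<dots> \<le> N ^ ((2 * d + 1) * k)"
      using N1 k1 by (intro power_increasing) (auto simp: algebra_simps intro: trans_le_add2)
    finally have "card Q + card S \<le> 2 * N ^ ((2 * d + 1) * k)" using cS by simp
    \<comment> \<open>Since \<open>N \<ge> 2\<close>, the factor 2 costs one more power of
      \<open>N\<close>, the \<open>+ 1\<close> in the exponent.\<close>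
    also have "\<dots> \<le> N * N ^ ((2 * d + 1) * k)" using N by (intro mult_right_mono) auto
    also have "\<dots> = N ^ ((2 * d + 1) * k + 1)" by simp
    finally have "real (card Q + card S) \<le> real (N ^ ((2 * d + 1) * k + 1))" by (rule of_nat_mono)
    then show "real (card Q) + real (card S) \<le> real N ^ ((2 * d + 1) * k + 1)" by simp
  qed simp
  finally show ?thesis .
qed

section \<open>Choice of the constants\<close>

theorem mainTheorem10:
  fixes d :: nat
  assumes "d \<ge> 2"
  shows "\<exists>C1 C2 :: real. C1 > 0 \<and> C2 > 0 \<and>
    (\<forall>\<eta> > 0. \<exists>N0 :: nat. \<forall>N \<ge> N0. N \<ge> 2 \<longrightarrow>
      (\<forall>K M :: nat. \<forall>X :: multi_index \<Rightarrow> real.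
         K \<ge> 1 \<longrightarrow> M \<ge> 1 \<longrightarrow>
         real M \<ge> (if d = 2 then C1 * real K * (log 2 (real N))^2 * ln (real N)
                   else C2 * real K * ln (real N)) \<longrightarrow>
         X \<in> grid_vectors d N \<longrightarrow>
         gradient_sparsity d N X \<le> K \<longrightarrow>
         \<P>(A in gaussian_matrix d N M.
            tv_minimizers d N M A (apply_matrix d N M A X) = {X}) \<ge> 1 - \<eta>))"
proof -
  obtain \<phi> c where c: "c > 0"
    and \<phi>: "\<And>m n. 1 \<le> m \<Longrightarrow> 3 * m \<le> 2 * n \<Longrightarrow> \<phi> m + 6 * real n powr (1 / real d - 1 / 2) \<le> \<phi> n"
    and \<phi>0: "\<And>n. n \<ge> 1 \<Longrightarrow> \<phi> n \<ge> 0"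
    and \<phi>c: "\<And>N. N \<ge> 2 \<Longrightarrow> \<phi> (N ^ d) \<le> c * (if d = 2 then log 2 (real N) else 1)"
    using splitting_weight_exists[OF assms] by auto
  \<comment> \<open>As \<open>sqrt K * L \<ge> 1\<close>, the radius
    \<open>\<kappa> * sqrt K * L\<close> absorbs both the summand 1 and the variation term.\<close>
  define \<kappa> where "\<kappa> = 1 + 4 * c * sqrt (real d)"
  define \<gamma> where "\<gamma> = ln (10 / 9 :: real)"
  have \<gamma>: "\<gamma> > 0" by (simp add: \<gamma>_def)
  have \<kappa>: "\<kappa> \<ge> 1" using c by (simp add: \<kappa>_def)
  \<comment> \<open>\<open>181 * \<kappa>\<^sup>2\<close> bounds \<open>k\<close> per unit of
    \<open>K * L\<^sup>2\<close> after rounding up, \<open>2 * d + 3\<close> bounds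
    \<open>(e + 1) / k\<close>, and \<open>\<gamma>\<close> is the decay rate of
    \<open>(9 / 10) ^ M\<close>.\<close>
  define C where "C = (2 * real d + 3) * (181 * \<kappa>\<^sup>2) / \<gamma>"
  have C: "C > 0" using \<gamma> \<kappa> by (simp add: C_def)
  have prob: "\<P>(A in gaussian_matrix d N M.
            tv_minimizers d N M A (apply_matrix d N M A X) = {X}) \<ge> 1 - \<eta>"
    if "\<eta> > 0" and N0: "N \<ge> nat \<lceil>1 / \<eta>\<rceil>" and N: "N \<ge> 2" and K1: "K \<ge> 1" and M1: "M \<ge> 1"
      and M: "real M \<ge> C * real K * (if d = 2 then log 2 (real N) else 1)\<^sup>2 * ln (real N)"
      and X: "X \<in> grid_vectors d N" and K: "gradient_sparsity d N X \<le> K"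
    for \<eta> :: real and N K M :: nat and X
  proof -
    let ?P = "gaussian_matrix d N M"
    define L where "L = (if d = 2 then log 2 (real N) else 1)"
    have L: "L \<ge> 1" using N by (simp add: L_def)
    define R where "R = \<kappa> * sqrt (real K) * L"
    have KL: "sqrt (real K) * L \<ge> 1"
      using mult_mono[of 1 "sqrt (real K)" 1 L] L K1 by simp
    have R1: "R \<ge> 1"
      using mult_mono[of 1 \<kappa> 1 "sqrt (real K) * L"] KL \<kappa> by (simp add: R_def mult.assoc)
    have "\<phi> (N ^ d) * (4 * sqrt (real d * real K)) \<le> c * L * (4 * sqrt (real d * real K))"
      using \<phi>c[OF N] unfolding L_def by (intro mult_right_mono) auto
    then have Rle: "1 + \<phi> (N ^ d) * (4 * sqrt (real d * real K)) \<le> R"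
      using KL by (simp add: R_def \<kappa>_def real_sqrt_mult algebra_simps)
    define k where "k = nat \<lceil>180 * R\<^sup>2\<rceil>"
    have R2: "R\<^sup>2 \<ge> 1" using R1 by simp
    have k: "180 * R\<^sup>2 \<le> real k" "real k \<le> 181 * R\<^sup>2"
      using R2 unfolding k_def by linarith+
    have k1: "real k \<ge> 1" using k R2 by linarith
    have lnN: "ln (real N) > 0" using N by simp
    have R2_eq: "R\<^sup>2 = \<kappa>\<^sup>2 * (real K * L\<^sup>2)" by (simp add: R_def power_mult_distrib)
    \<comment> \<open>\<open>e\<close> is the exponent from the union bound. \<open>M\<close> is
      made to beat \<open>N ^ (e + 1)\<close>, so that the spare power leaves a failure probability
      of at most \<open>1 / N\<close>.\<close>
    define e where "e = (2 * d + 1) * k + 1"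
    have "real (e + 1) \<le> (2 * real d + 3) * real k"
      using k1 by (simp add: e_def algebra_simps)
    also have "\<dots> \<le> (2 * real d + 3) * (181 * R\<^sup>2)" using k by (intro mult_left_mono) auto
    finally have "real (e + 1) * ln (real N) \<le> (2 * real d + 3) * (181 * R\<^sup>2) * ln (real N)"
      using lnN by (intro mult_right_mono) auto
    also have "\<dots> = \<gamma> * (C * real K * L\<^sup>2 * ln (real N))"
      using \<gamma> by (simp add: C_def R2_eq)
    also have "\<dots> \<le> \<gamma> * real M"
      using M \<gamma> unfolding L_def by (intro mult_left_mono) auto
    finally have "exp (real (e + 1) * ln (real N)) \<le> exp (\<gamma> * real M)" by simp
    moreover have "exp (real (e + 1) * ln (real N)) = real N ^ (e + 1)"
      using N by (subst exp_of_nat_mult) simp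
    moreover have "exp (\<gamma> * real M) = (10 / 9) ^ M"
      by (simp add: \<gamma>_def mult.commute[of _ "real M"] exp_of_nat_mult del: ln_div)
    ultimately have "real N ^ (e + 1) \<le> (10 / 9) ^ M" by simp
    then have "real N ^ (e + 1) * (9 / 10) ^ M \<le> (10 / 9) ^ M * (9 / 10) ^ M"
      by (rule mult_right_mono) simp
    also have "\<dots> = 1" by (simp add: power_mult_distrib[symmetric])
    finally have "real N ^ e * (9 / 10) ^ M \<le> 1 / real N"
      using N by (simp add: field_simps)
    also have "\<dots> \<le> \<eta>"
    proof -
      have "1 / \<eta> \<le> real N" using N0 by linarith
      then show ?thesis using \<open>\<eta> > 0\<close> N by (simp add: field_simps)
    qed
    finally have small: "real N ^ e * (9 / 10) ^ M \<le> \<eta>" .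
    have psn: "prob_space std_normal"
      using prob_space_normal_density[of 1 0] by simp
    interpret P: prob_space ?P
      unfolding gaussian_matrix_def by (intro prob_space_PiM psn)
    have N1: "N \<ge> 1" "d \<ge> 1" using N assms by auto
    have ms: "descent_kernel_event d N M X \<in> sets ?P" by (rule descent_kernel_event_measurable[OF N1(1)])
    have "{A \<in> space ?P. tv_minimizers d N M A (apply_matrix d N M A X) = {X}}
        = space ?P - descent_kernel_event d N M X"
      using tv_minimizers_eq_singleton_iff[OF N1(1) X] by auto
    then have "\<P>(A in ?P. tv_minimizers d N M A (apply_matrix d N M A X) = {X})
        = 1 - measure ?P (descent_kernel_event d N M X)"
      using P.prob_compl[OF ms] by simp
    moreover have "measure ?P (descent_kernel_event d N M X) \<le> \<eta>"
      using measure_descent_kernel_event_le[OF \<phi> \<phi>0 N1(2) N M1 K Rle k(1)] small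
      by (simp add: e_def)
    ultimately show ?thesis by simp
  qed
  show ?thesis
  \<comment> \<open>One \<open>C\<close> serves both cases, the logarithmic factor being 1 for
    \<open>d > 2\<close>; the threshold on \<open>N\<close> turns \<open>1 / N\<close> into a bound
    by \<open>\<eta>\<close>.\<close>
  proof (intro exI[of _ C] conjI C allI impI)
    fix \<eta> :: real assume "\<eta> > 0"
    then show "\<exists>N0. \<forall>N\<ge>N0. 2 \<le> N \<longrightarrow>
      (\<forall>K M X. 1 \<le> K \<longrightarrow> 1 \<le> M \<longrightarrow>
         (if d = 2 then C * real K * (log 2 (real N))\<^sup>2 * ln (real N) else C * real K * ln (real N)) \<le> real M \<longrightarrow>
         X \<in> grid_vectors d N \<longrightarrow> gradient_sparsity d N X \<le> K \<longrightarrow>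
         1 - \<eta> \<le> \<P>(A in gaussian_matrix d N M. tv_minimizers d N M A (apply_matrix d N M A X) = {X}))"
      by (intro exI[of _ "nat \<lceil>1 / \<eta>\<rceil>"] allI impI prob) (auto split: if_splits)
  qed
qed

end
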